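(* Suppose $\Sigma$ is a smooth, proper fan, and let $Z_\Sigma \subset \mathbb{A}^{\Sigma(1)}$ be the coordinate subspace arrangement (irrelevant subvariety) associated with $\Sigma$. Let $d$ be an integer with $1 \leq d \leq |\Sigma(1)|$. (1) $Z_\Sigma$ has codimension $\geq d$ in $\mathbb{A}^{\Sigma(1)}$ if and only if every collection of $d-1$ distinct primitive vectors in $\Sigma$ is part of a cone in $\Sigma$. (2) If, in addition to the condition in (1), there exists a collection of $d$ primitive vectors that are not part of some cone of $\Sigma$, then $Z_\Sigma$ has a component of codimension precisely $d$. The set of components of $Z_\Sigma$ of codimension exactly $d$ is in canonical bijection with the set of (unordered) collections of $d$ primitive vectors that are not part of some cone of $\Sigma$. (3) Suppose $Z_\Sigma$ has codimension $d$ in $\mathbb{A}^{\Sigma(1)}$. Then the intersection of two codimension $d$ subspaces (components) of $Z_\Sigma$ has codimension $d+1$ in $\mathbb{A}^{\Sigma(1)}$ if and only if, under the bijection in (2), the corresponding collections have $d-1$ primitive vectors in common. (4) Suppose $Z_\Sigma$ has codimension $d$ in $\mathbb{A}^{\Sigma(1)}$. All intersections of (two distinct) codimension $d$ components of $Z_\Sigma$ have codimension at least $d+2$ in $\mathbb{A}^{\Sigma(1)}$ if and only if for every set of $d-1$ primitive vectors $\{\rho_1,\ldots,\rho_{d-1}\}$ spanning a cone, there exists at most one primitive vector $\rho_d$ (distinct from $\rho_1,\ldots,\rho_{d-1}$) such that $\{\rho_1,\ldots,\rho_{d-1},\rho_d\}$ does not span a cone.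
   Context: Let $k$ be a field and $T$ a split torus over $k$ with cocharacter lattice $\mathrm{X}_*(T)$. A fan $\Sigma$ in $\mathrm{X}_*(T)$ is a collection of strongly convex rational polyhedral cones in $N_{\mathbb{R}} = \mathrm{X}_*(T)\otimes_{\mathbb{Z}}\mathbb{R}$, closed under faces and with the intersection of any two cones a face of each. $\Sigma$ is smooth if every cone is generated by part of a basis of $\mathrm{X}_*(T)$, and proper if the union of its cones is $N_{\mathbb{R}}$. $\Sigma(1)$ is the set of $1$-dimensional cones; the primitive vectors in $\Sigma$ are the primitive generators of the cones in $\Sigma(1)$. Collections of primitive vectors consist of pairwise distinct vectors; a collection is part of a cone of $\Sigma$ if some cone of $\Sigma$ has all of them among its primitive generators (for smooth $\Sigma$, equivalently they span a cone of $\Sigma$). Coordinates $x_\rho$ on the affine space $\mathbb{A}^{\Sigma(1)}$ over $k$ are indexed by $\Sigma(1)$; $Z_\Sigma$ is the zero locus of the ideal generated by the monomials $x^{\hat\sigma} = \prod_{\rho\notin\sigma(1)}x_\rho$ for $\sigma\in\Sigma$, where $\sigma(1)$ is the set of rays of $\sigma$. It is a union of coordinate subspaces. "Codimension $\geq d$" means every component has codimension $\geq d$; "codimension $d$" means moreover some component has codimension exactly $d$. The canonical bijection associates to a collection $\{\rho_{i_1},\ldots,\rho_{i_d}\}$ the component $x_{\rho_{i_1}}=\cdots=x_{\rho_{i_d}}=0$. *)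

theory Defs
  imports
    "HOL-Analysis.Analysis"
    "HOL-Algebra.Ideal"
    "HOL-Library.Poly_Mapping"
begin

section \<open>Lattices, cones and fans\<close>

text \<open>
  A split torus enters only through its cocharacter lattice, which can be any free abelian
  group of finite rank. It is represented by a lattice \<open>L\<close> of full rank in the real vector
  space \<open>UNIV :: 'v set\<close>, which plays the role of \<open>N\<^sub>\<real> = L \<otimes> \<real>\<close>.
\<close>

definition lattice_basis :: "'v::real_vector set \<Rightarrow> 'v set \<Rightarrow> bool" where
  "lattice_basis L B \<longleftrightarrow>
     finite B \<and> independent B \<and> span B = UNIV \<and>
     L = {\<Sum>b\<in>B. of_int (c b) *\<^sub>R b | c. True}"

definition full_lattice :: "'v::real_vector set \<Rightarrow> bool" where
  "full_lattice L \<longleftrightarrow> (\<exists>B. lattice_basis L B)"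

definition rational_polyhedral_cone :: "'v::real_vector set \<Rightarrow> 'v set \<Rightarrow> bool" where
  "rational_polyhedral_cone L \<sigma> \<longleftrightarrow> (\<exists>G. finite G \<and> G \<subseteq> L \<and> \<sigma> = convex_cone hull G)"

definition strongly_convex :: "'v::real_vector set \<Rightarrow> bool" where
  "strongly_convex \<sigma> \<longleftrightarrow> (\<forall>x. x \<in> \<sigma> \<and> - x \<in> \<sigma> \<longrightarrow> x = 0)"

text \<open>The library notion \<^term>\<open>(face_of)\<close> admits the empty face, which is not a cone.\<close>

definition cone_face_of :: "'v::real_vector set \<Rightarrow> 'v set \<Rightarrow> bool" where
  "cone_face_of \<tau> \<sigma> \<longleftrightarrow> \<tau> face_of \<sigma> \<and> \<tau> \<noteq> {}"

definition fan :: "'v::real_vector set \<Rightarrow> 'v set set \<Rightarrow> bool" where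
  "fan L \<Sigma> \<longleftrightarrow>
     finite \<Sigma> \<and>
     (\<forall>\<sigma>\<in>\<Sigma>. rational_polyhedral_cone L \<sigma> \<and> strongly_convex \<sigma>) \<and>
     (\<forall>\<sigma>\<in>\<Sigma>. \<forall>\<tau>. cone_face_of \<tau> \<sigma> \<longrightarrow> \<tau> \<in> \<Sigma>) \<and>
     (\<forall>\<sigma>\<in>\<Sigma>. \<forall>\<tau>\<in>\<Sigma>. cone_face_of (\<sigma> \<inter> \<tau>) \<sigma> \<and> cone_face_of (\<sigma> \<inter> \<tau>) \<tau>)"

definition smooth_fan :: "'v::real_vector set \<Rightarrow> 'v set set \<Rightarrow> bool" where
  "smooth_fan L \<Sigma> \<longleftrightarrow>
     fan L \<Sigma> \<and> (\<forall>\<sigma>\<in>\<Sigma>. \<exists>B G. lattice_basis L B \<and> G \<subseteq> B \<and> \<sigma> = convex_cone hull G)"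

definition proper_fan :: "'v::real_vector set \<Rightarrow> 'v set set \<Rightarrow> bool" where
  "proper_fan L \<Sigma> \<longleftrightarrow> fan L \<Sigma> \<and> \<Union>\<Sigma> = UNIV"

definition fan_rays :: "'v::real_vector set set \<Rightarrow> 'v set set" where
  "fan_rays \<Sigma> = {\<rho> \<in> \<Sigma>. dim \<rho> = 1}"

definition cone_rays :: "'v::real_vector set set \<Rightarrow> 'v set \<Rightarrow> 'v set set" where
  "cone_rays \<Sigma> \<sigma> = {\<rho> \<in> fan_rays \<Sigma>. cone_face_of \<rho> \<sigma>}"

definition primitive :: "'v::real_vector set \<Rightarrow> 'v \<Rightarrow> bool" where
  "primitive L u \<longleftrightarrow>
     u \<in> L \<and> u \<noteq> 0 \<and> (\<forall>w\<in>L. \<forall>n::int. u = of_int n *\<^sub>R w \<longrightarrow> \<bar>n\<bar> = 1)"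

definition primitive_generator :: "'v::real_vector set \<Rightarrow> 'v set \<Rightarrow> 'v \<Rightarrow> bool" where
  "primitive_generator L \<rho> u \<longleftrightarrow> primitive L u \<and> \<rho> = convex_cone hull {u}"

definition primitive_vectors :: "'v::real_vector set \<Rightarrow> 'v set set \<Rightarrow> 'v set" where
  "primitive_vectors L \<Sigma> = {u. \<exists>\<rho>\<in>fan_rays \<Sigma>. primitive_generator L \<rho> u}"

definition primitive_generators_of ::
    "'v::real_vector set \<Rightarrow> 'v set set \<Rightarrow> 'v set \<Rightarrow> 'v set" where
  "primitive_generators_of L \<Sigma> \<sigma> = {u. \<exists>\<rho>\<in>cone_rays \<Sigma> \<sigma>. primitive_generator L \<rho> u}"

text \<open>Collections of \<open>n\<close> pairwise distinct primitive vectors.\<close>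

definition primitive_collections ::
    "'v::real_vector set \<Rightarrow> 'v set set \<Rightarrow> nat \<Rightarrow> 'v set set" where
  "primitive_collections L \<Sigma> n = {C. C \<subseteq> primitive_vectors L \<Sigma> \<and> finite C \<and> card C = n}"

definition part_of_cone :: "'v::real_vector set \<Rightarrow> 'v set set \<Rightarrow> 'v set \<Rightarrow> bool" where
  "part_of_cone L \<Sigma> C \<longleftrightarrow> (\<exists>\<sigma>\<in>\<Sigma>. C \<subseteq> primitive_generators_of L \<Sigma> \<sigma>)"

definition spans_cone :: "'v::real_vector set set \<Rightarrow> 'v set \<Rightarrow> bool" where
  "spans_cone \<Sigma> C \<longleftrightarrow> convex_cone hull C \<in> \<Sigma>"


section \<open>Affine space over a field, with coordinates indexed by a set\<close>

text \<open>
  Exponent vectors are finitely supported functions \<open>'i \<Rightarrow>\<^sub>0 nat\<close>. Since the index set \<open>I\<close> need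
  not be a whole type, the ring \<open>k[x\<^sub>i | i \<in> I]\<close> is a subring of the type of all polynomials.
\<close>

type_synonym ('i, 'k) mpoly = "('i \<Rightarrow>\<^sub>0 nat) \<Rightarrow>\<^sub>0 'k"

definition coord :: "'i \<Rightarrow> ('i, 'k::field) mpoly" where
  "coord i = Poly_Mapping.single (Poly_Mapping.single i 1) 1"

definition polynomial_ring :: "'i set \<Rightarrow> ('i, 'k::field) mpoly ring" where
  "polynomial_ring I =
     \<lparr>carrier = {p. \<forall>m\<in>Poly_Mapping.keys p. Poly_Mapping.keys m \<subseteq> I},
      mult = (*), one = 1, zero = 0, add = (+)\<rparr>"

definition spec :: "('a, 'b) ring_scheme \<Rightarrow> 'a set set" where
  "spec R = {P. primeideal P R}"

definition zero_locus :: "('a, 'b) ring_scheme \<Rightarrow> 'a set \<Rightarrow> 'a set set" where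
  "zero_locus R E = {P \<in> spec R. E \<subseteq> P}"

text \<open>The Zariski topology, generated by the distinguished open sets \<open>D(f)\<close>.\<close>

definition zariski :: "('a, 'b) ring_scheme \<Rightarrow> 'a set topology" where
  "zariski R = topology_generated_by ((\<lambda>f. {P \<in> spec R. f \<notin> P}) ` carrier R)"

text \<open>
  The points of \<open>\<bbbA>\<^sup>I\<close> are those of the scheme, i.e. prime ideals: over a field that is not
  algebraically closed (possibly finite), \<open>k\<close>-rational points would not determine components
  and codimensions.
\<close>

definition affine_space :: "'i set \<Rightarrow> ('i, 'k::field) mpoly set topology" where
  "affine_space I = zariski (polynomial_ring I)"


section \<open>Components and codimension\<close>

definition irreducible_subset :: "'a topology \<Rightarrow> 'a set \<Rightarrow> bool" where
  "irreducible_subset X Y \<longleftrightarrow>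
     Y \<subseteq> topspace X \<and> Y \<noteq> {} \<and>
     (\<forall>A B. closedin X A \<and> closedin X B \<and> Y \<subseteq> A \<union> B \<longrightarrow> Y \<subseteq> A \<or> Y \<subseteq> B)"

definition components_of_subset :: "'a topology \<Rightarrow> 'a set \<Rightarrow> 'a set set" where
  "components_of_subset X S =
     {Y. irreducible_subset X Y \<and> Y \<subseteq> S \<and>
         (\<forall>Y'. irreducible_subset X Y' \<and> Y \<subseteq> Y' \<and> Y' \<subseteq> S \<longrightarrow> Y' = Y)}"

text \<open>
  Codimension of an irreducible closed subset \<open>Y\<close>: the supremum of the lengths of chains
  \<open>Y = W\<^sub>0 \<subset> W\<^sub>1 \<subset> \<dots> \<subset> W\<^sub>n\<close> of irreducible closed subsets of \<open>X\<close>.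
\<close>

definition irreducible_codim :: "'a topology \<Rightarrow> 'a set \<Rightarrow> enat" where
  "irreducible_codim X Y =
     Sup {enat n | n. \<exists>W :: nat \<Rightarrow> 'a set. W 0 = Y \<and>
            (\<forall>i\<le>n. closedin X (W i) \<and> irreducible_subset X (W i)) \<and>
            (\<forall>i<n. W i \<subset> W (Suc i))}"

definition components_of_codim :: "'a topology \<Rightarrow> 'a set \<Rightarrow> nat \<Rightarrow> 'a set set" where
  "components_of_codim X S d =
     {Y \<in> components_of_subset X S. irreducible_codim X Y = enat d}"

definition codim_ge :: "'a topology \<Rightarrow> 'a set \<Rightarrow> nat \<Rightarrow> bool" where
  "codim_ge X S d \<longleftrightarrow> (\<forall>Y\<in>components_of_subset X S. enat d \<le> irreducible_codim X Y)"

definition has_codim :: "'a topology \<Rightarrow> 'a set \<Rightarrow> nat \<Rightarrow> bool" where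
  "has_codim X S d \<longleftrightarrow> codim_ge X S d \<and> components_of_codim X S d \<noteq> {}"


section \<open>The irrelevant locus\<close>

definition cone_monomial :: "'v::real_vector set set \<Rightarrow> 'v set \<Rightarrow> ('v set, 'k::field) mpoly" where
  "cone_monomial \<Sigma> \<sigma> = (\<Prod>\<rho>\<in>fan_rays \<Sigma> - cone_rays \<Sigma> \<sigma>. coord \<rho>)"

definition irrelevant_ideal :: "'v::real_vector set set \<Rightarrow> ('v set, 'k::field) mpoly set" where
  "irrelevant_ideal \<Sigma> = Idl\<^bsub>polynomial_ring (fan_rays \<Sigma>)\<^esub> (cone_monomial \<Sigma> ` \<Sigma>)"

definition irrelevant_locus :: "'v::real_vector set set \<Rightarrow> ('v set, 'k::field) mpoly set set" where
  "irrelevant_locus \<Sigma> = zero_locus (polynomial_ring (fan_rays \<Sigma>)) (irrelevant_ideal \<Sigma>)"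

text \<open>
  For a collection \<open>C\<close> of primitive vectors, the subspace where \<open>x\<^sub>\<rho> = 0\<close> for every ray \<open>\<rho>\<close>
  generated by a member of \<open>C\<close>.
\<close>

definition coordinate_subspace ::
    "'v::real_vector set \<Rightarrow> 'v set set \<Rightarrow> 'v set \<Rightarrow> ('v set, 'k::field) mpoly set set" where
  "coordinate_subspace L \<Sigma> C =
     zero_locus (polynomial_ring (fan_rays \<Sigma>))
       (coord ` {\<rho> \<in> fan_rays \<Sigma>. \<exists>u\<in>C. primitive_generator L \<rho> u})"

end

theory Submission
  imports Defs
begin

text \<open>
  Sets of primitive vectors that are part of a cone form a simplicial complex, and \<open>Z\<^sub>\<Sigma>\<close> is the
  union of the coordinate subspaces \<open>V(x\<^sub>C)\<close> over its minimal nonfaces \<open>C\<close>. Those subspaces are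
  irreducible and pairwise incomparable, hence they are the components, and \<open>V(x\<^sub>C)\<close> has codimension
  \<open>card C\<close>; the rest is counting in the complex.

  The upper bound on the codimension is a transcendence degree argument: if \<open>P \<subset> Q\<close> are primes and a
  set \<open>S\<close> of variables is algebraically independent modulo \<open>Q\<close>, then some larger set
  \<open>S \<union> {i}\<close> is independent modulo \<open>P\<close>. A chain of \<open>n\<close> primes below \<open>(x\<^sub>i | i \<in> C)\<close> therefore turns
  the complement of \<open>C\<close> into an independent set with \<open>n\<close> more variables.
\<close>

section \<open>Algebraic dependence modulo a prime ideal\<close>

text \<open>Smoothness enters through one fact: a primitive vector lying in a cone is one of the
  basis vectors that generate the cone. Any set of primitive vectors inside a cone therefore spans a
  face of it, which identifies \<open>part_of_cone\<close> with \<open>spans_cone\<close> in part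
  (4). The upper bound on the codimension is the hard half. It calls for linear algebra over the
  fraction field of k[S], inside the fraction field of k[I] / P, but neither the quotient nor the
  fields are formed. All elements stay in one ring type, with \<open>R\<close> = k[I],
  \<open>U\<close> = k[S] and \<open>p\<close> = P: equality becomes congruence modulo
  \<open>p\<close>, and division becomes cancellation of a nonzero factor from \<open>U\<close>.
  Such factors can be cancelled because \<open>U\<close> meets \<open>p\<close> only in 0. It is
  enough that finitely many elements span \<open>R\<close> in this sense, since sufficiently many
  powers of one element are then dependent.\<close>

locale subring_mod_prime =
  fixes R U p :: "'a::comm_ring_1 set"
  assumes U_sub: "U \<subseteq> R"
    and R_1: "1 \<in> R"
    and R_add: "a \<in> R \<Longrightarrow> b \<in> R \<Longrightarrow> a + b \<in> R"
    and R_mult: "a \<in> R \<Longrightarrow> b \<in> R \<Longrightarrow> a * b \<in> R"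
    and U_1: "1 \<in> U"
    and U_add: "a \<in> U \<Longrightarrow> b \<in> U \<Longrightarrow> a + b \<in> U"
    and U_mult: "a \<in> U \<Longrightarrow> b \<in> U \<Longrightarrow> a * b \<in> U"
    and U_uminus: "a \<in> U \<Longrightarrow> - a \<in> U"
    and p_sub: "p \<subseteq> R"
    and p_0: "0 \<in> p"
    and p_add: "a \<in> p \<Longrightarrow> b \<in> p \<Longrightarrow> a + b \<in> p"
    and p_mult: "a \<in> p \<Longrightarrow> r \<in> R \<Longrightarrow> r * a \<in> p"
    and p_prime: "a \<in> R \<Longrightarrow> b \<in> R \<Longrightarrow> a * b \<in> p \<Longrightarrow> a \<in> p \<or> b \<in> p"
    and U_p: "a \<in> U \<Longrightarrow> a \<in> p \<Longrightarrow> a = 0"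
    and one_neq: "1 \<notin> p"
begin

lemma R_0: "0 \<in> R"
  using p_0 p_sub by blast

lemma U_0: "0 \<in> U"
  using U_add[OF U_1 U_uminus[OF U_1]] by simp

lemma R_power: "a \<in> R \<Longrightarrow> a ^ n \<in> R"
  by (induction n) (auto simp: R_1 R_mult)

lemma U_sum: "(\<And>i. i \<in> I \<Longrightarrow> f i \<in> U) \<Longrightarrow> sum f I \<in> U"
  by (induction I rule: infinite_finite_induct) (auto simp: U_0 U_add)

lemma R_sum: "(\<And>i. i \<in> I \<Longrightarrow> f i \<in> R) \<Longrightarrow> sum f I \<in> R"
  by (induction I rule: infinite_finite_induct) (auto simp: R_0 R_add)

lemma p_sum: "(\<And>i. i \<in> I \<Longrightarrow> f i \<in> p) \<Longrightarrow> sum f I \<in> p"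
  by (induction I rule: infinite_finite_induct) (auto simp: p_0 p_add)

lemma p_power:
  assumes "a \<in> R" "a ^ n \<in> p"
  shows "a \<in> p"
  using assms(2) by (induction n) (use assms(1) one_neq p_prime R_power in auto)

text \<open>\<open>U\<close> embeds into the domain \<open>R / p\<close>, because it meets
  \<open>p\<close> only in 0.\<close>

lemma U_no_zero_divisors:
  assumes "a \<in> U" "b \<in> U" "a * b = 0"
  shows "a = 0 \<or> b = 0"
  using p_prime[of a b] assms U_sub p_0 U_p by auto

text \<open>Gaussian elimination without division, over the domain \<open>U\<close>: each induction
  step uses one row as pivot to remove one coordinate, so rows remain in excess until no coordinate
  is left.\<close>

lemma linear_dependence:
  assumes "finite T" "finite J" "card T < card J"
    and "\<And>j t. j \<in> J \<Longrightarrow> t \<in> T \<Longrightarrow> c j t \<in> U"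
  shows "\<exists>b. (\<forall>j\<in>J. b j \<in> U) \<and> (\<exists>j\<in>J. b j \<noteq> 0) \<and> (\<forall>t\<in>T. (\<Sum>j\<in>J. b j * c j t) = 0)"
  using assms
proof (induction T arbitrary: J c rule: finite_induct)
  case empty
  then have "J \<noteq> {}" by auto
  moreover have "(1::'a) \<noteq> 0" using p_0 one_neq by metis
  ultimately show ?case using U_1 by (intro exI[of _ "\<lambda>_. 1"]) auto
next
  case (insert s T)
  show ?case
  proof (cases "\<exists>i\<in>J. c i s \<noteq> 0")
    case False
    have "card T < card J" using insert by simp
    then obtain b where b: "\<forall>j\<in>J. b j \<in> U" "\<exists>j\<in>J. b j \<noteq> 0" "\<forall>t\<in>T. (\<Sum>j\<in>J. b j * c j t) = 0"
      using insert.IH[of J c] insert.prems by auto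
    with False show ?thesis by (intro exI[of _ b]) auto
  next
    case True
    then obtain i where i: "i \<in> J" "c i s \<noteq> 0" by blast
    define J' where "J' = J - {i}"
    \<comment> \<open>The minors of size 2 on the pivot row \<open>i\<close> and the pivot column
      \<open>s\<close>; they vanish at \<open>t = s\<close>.\<close>
    define c' where "c' j t = c i s * c j t - c j s * c i t" for j t
    have "card T < card J'" "finite J'" using insert i by (auto simp: J'_def)
    moreover have "c' j t \<in> U" if "j \<in> J'" "t \<in> T" for j t
      unfolding c'_def diff_conv_add_uminus
      using that insert.prems i by (intro U_add U_uminus U_mult) (auto simp: J'_def)
    ultimately obtain b where b: "\<forall>j\<in>J'. b j \<in> U" "\<exists>j\<in>J'. b j \<noteq> 0"
      "\<forall>t\<in>T. (\<Sum>j\<in>J'. b j * c' j t) = 0"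
      using insert.IH[of J' c'] by blast
    \<comment> \<open>The relation among the reduced rows, rewritten in the original rows: expanding
      \<open>c'\<close> multiplies the other coefficients by the pivot and collects the rest on row
      \<open>i\<close>.\<close>
    define b' where "b' j = (if j = i then - (\<Sum>l\<in>J'. b l * c l s) else b j * c i s)" for j
    have split: "(\<Sum>j\<in>J. b' j * c j t) = (\<Sum>j\<in>J'. b j * c' j t)" for t
    proof -
      have "(\<Sum>j\<in>J. b' j * c j t) = b' i * c i t + (\<Sum>j\<in>J'. b' j * c j t)"
        unfolding J'_def using insert i by (simp add: sum.remove)
      also have "(\<Sum>j\<in>J'. b' j * c j t) = (\<Sum>j\<in>J'. b j * c i s * c j t)"
        by (intro sum.cong) (auto simp: b'_def J'_def)
      also have "b' i * c i t = - (\<Sum>j\<in>J'. b j * c j s * c i t)"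
        by (simp add: b'_def sum_distrib_right)
      finally show ?thesis
        by (simp add: c'_def algebra_simps flip: sum_subtractf)
    qed
    have "(\<Sum>j\<in>J'. b j * c' j s) = 0"
      by (simp add: c'_def mult.commute)
    with b have "\<forall>t\<in>insert s T. (\<Sum>j\<in>J. b' j * c j t) = 0"
      by (simp add: split)
    moreover have "\<forall>j\<in>J. b' j \<in> U"
      using b insert.prems i by (auto simp: b'_def J'_def intro!: U_uminus U_sum U_mult)
    moreover have "\<exists>j\<in>J. b' j \<noteq> 0"
    proof -
      obtain j where j: "j \<in> J'" "b j \<noteq> 0" using b by blast
      then have "b j * c i s \<noteq> 0"
        using U_no_zero_divisors[of "b j" "c i s"] b insert.prems i by blast
      with j show ?thesis by (intro bexI[of _ j]) (auto simp: b'_def J'_def)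
    qed
    ultimately show ?thesis by blast
  qed
qed

text \<open>
  The elements of \<open>R\<close> whose class lies in the span of \<open>T\<close> over the fraction field of \<open>U\<close>,
  inside the fraction field of \<open>R / p\<close>.
\<close>

inductive_set frac_span :: "'a set \<Rightarrow> 'a set" for T where
  base: "t \<in> T \<Longrightarrow> t \<in> frac_span T"
| prime: "x \<in> p \<Longrightarrow> x \<in> frac_span T"
| add: "x \<in> frac_span T \<Longrightarrow> y \<in> frac_span T \<Longrightarrow> x + y \<in> frac_span T"
| scale: "u \<in> U \<Longrightarrow> x \<in> frac_span T \<Longrightarrow> u * x \<in> frac_span T"
| cancel: "u \<in> U \<Longrightarrow> u \<noteq> 0 \<Longrightarrow> x \<in> R \<Longrightarrow> u * x \<in> frac_span T \<Longrightarrow> x \<in> frac_span T"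

lemma frac_span_sum: "(\<And>i. i \<in> I \<Longrightarrow> f i \<in> frac_span T) \<Longrightarrow> sum f I \<in> frac_span T"
  by (induction I rule: infinite_finite_induct) (auto intro: frac_span.intros simp: p_0)

text \<open>Clearing denominators: a sum takes the product of both denominators and a cancellation
  multiplies the denominator by the cancelled factor. These products stay nonzero because
  \<open>U\<close> is a domain.\<close>

lemma frac_span_normal_form:
  assumes "finite T" "T \<subseteq> R" "x \<in> frac_span T"
  shows "\<exists>u c. u \<in> U \<and> u \<noteq> 0 \<and> (\<forall>t\<in>T. c t \<in> U) \<and> u * x - (\<Sum>t\<in>T. c t * t) \<in> p"
  using assms(3)
proof induction
  case (base t)
  have "(1::'a) \<noteq> 0" using p_0 one_neq by metis
  moreover have "(\<Sum>s\<in>T. (if s = t then 1 else 0) * s) = t"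
    using base assms(1) by (simp add: if_distrib[of "\<lambda>x. x * _"] cong: if_cong)
  ultimately show ?case
    using U_1 U_0 p_0 by (intro exI[of _ 1] exI[of _ "\<lambda>s. if s = t then 1 else 0"]) auto
next
  case (prime x)
  have "(1::'a) \<noteq> 0" using p_0 one_neq by metis
  then show ?case
    using U_1 U_0 prime by (intro exI[of _ 1] exI[of _ "\<lambda>s. 0"]) auto
next
  case (add x y)
  then obtain u c v d where
    u: "u \<in> U" "u \<noteq> 0" "\<forall>t\<in>T. c t \<in> U" "u * x - (\<Sum>t\<in>T. c t * t) \<in> p" and
    v: "v \<in> U" "v \<noteq> 0" "\<forall>t\<in>T. d t \<in> U" "v * y - (\<Sum>t\<in>T. d t * t) \<in> p" by blast
  have "v * (u * x - (\<Sum>t\<in>T. c t * t)) + u * (v * y - (\<Sum>t\<in>T. d t * t)) \<in> p"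
    using u v U_sub by (intro p_add p_mult) auto
  also have "v * (u * x - (\<Sum>t\<in>T. c t * t)) + u * (v * y - (\<Sum>t\<in>T. d t * t)) =
     (u * v) * (x + y) - (\<Sum>t\<in>T. (v * c t + u * d t) * t)"
    by (simp add: algebra_simps sum_distrib_left sum.distrib)
  finally show ?case
    using u v U_no_zero_divisors[of u v]
    by (intro exI[of _ "u * v"] exI[of _ "\<lambda>t. v * c t + u * d t"]) (auto intro: U_add U_mult)
next
  case (scale w x)
  then obtain u c where
    u: "u \<in> U" "u \<noteq> 0" "\<forall>t\<in>T. c t \<in> U" "u * x - (\<Sum>t\<in>T. c t * t) \<in> p" by blast
  have "w * (u * x - (\<Sum>t\<in>T. c t * t)) \<in> p"
    using u scale U_sub by (intro p_mult) auto
  also have "w * (u * x - (\<Sum>t\<in>T. c t * t)) = u * (w * x) - (\<Sum>t\<in>T. (w * c t) * t)"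
    by (simp add: algebra_simps sum_distrib_left)
  finally show ?case
    using u scale by (intro exI[of _ u] exI[of _ "\<lambda>t. w * c t"]) (auto intro: U_mult)
next
  case (cancel w x)
  then obtain u c where
    u: "u \<in> U" "u \<noteq> 0" "\<forall>t\<in>T. c t \<in> U" "u * (w * x) - (\<Sum>t\<in>T. c t * t) \<in> p" by blast
  then show ?case
    using cancel U_no_zero_divisors[of u w]
    by (intro exI[of _ "u * w"] exI[of _ c]) (auto intro: U_mult simp: mult.assoc)
qed

text \<open>The indices \<open>0..card T\<close> number one more than the elements of
  \<open>T\<close>, so the numerators of the \<open>F j\<close> have dependent coefficient vectors.
  Multiplying that relation by the denominators gives the claim.\<close>

lemma frac_span_dependent:
  assumes T: "finite T" "T \<subseteq> R" and F: "\<And>j. j \<le> card T \<Longrightarrow> F j \<in> frac_span T"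
  shows "\<exists>b. (\<forall>j\<le>card T. b j \<in> U) \<and> (\<exists>j\<le>card T. b j \<noteq> 0) \<and> (\<Sum>j\<le>card T. b j * F j) \<in> p"
proof -
  have "\<forall>j\<in>{..card T}. \<exists>u c. u \<in> U \<and> u \<noteq> 0 \<and> (\<forall>t\<in>T. c t \<in> U) \<and> u * F j - (\<Sum>t\<in>T. c t * t) \<in> p"
    using frac_span_normal_form[OF T] F by blast
  then obtain u c where uc: "\<forall>j\<in>{..card T}. u j \<in> U \<and> u j \<noteq> 0 \<and> (\<forall>t\<in>T. c j t \<in> U) \<and>
      u j * F j - (\<Sum>t\<in>T. c j t * t) \<in> p"
    by metis
  obtain b where b: "\<forall>j\<in>{..card T}. b j \<in> U" "\<exists>j\<in>{..card T}. b j \<noteq> 0"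
    "\<forall>t\<in>T. (\<Sum>j\<le>card T. b j * c j t) = 0"
    using linear_dependence[of T "{..card T}" c] T uc by auto
  have "(\<Sum>j\<le>card T. b j * (u j * F j - (\<Sum>t\<in>T. c j t * t))) \<in> p"
    using uc b U_sub by (intro p_sum p_mult) auto
  also have "(\<Sum>j\<le>card T. b j * (u j * F j - (\<Sum>t\<in>T. c j t * t))) =
      (\<Sum>j\<le>card T. b j * u j * F j) - (\<Sum>j\<le>card T. \<Sum>t\<in>T. b j * c j t * t)"
    by (simp add: algebra_simps sum_subtractf sum_distrib_left)
  also have "(\<Sum>j\<le>card T. \<Sum>t\<in>T. b j * c j t * t) = (\<Sum>t\<in>T. (\<Sum>j\<le>card T. b j * c j t) * t)"
    by (subst sum.swap) (simp add: sum_distrib_right)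
  also have "\<dots> = 0" using b by simp
  finally have "(\<Sum>j\<le>card T. b j * u j * F j) \<in> p" by simp
  moreover have "\<exists>j\<le>card T. b j * u j \<noteq> 0"
    using b uc U_no_zero_divisors by (metis atMost_iff)
  ultimately show ?thesis
    using b uc by (intro exI[of _ "\<lambda>j. b j * u j"]) (auto intro: U_mult)
qed

text \<open>Finiteness of an algebraic extension: the relation, divided by its leading coefficient,
  rewrites every power of \<open>x\<close> from \<open>x ^ d\<close> on through lower ones.
  Membership in the span does the division by means of \<open>cancel\<close>.\<close>

lemma frac_span_adjoin:
  assumes x: "x \<in> R" and T: "T \<subseteq> R"
    and a: "\<And>j. j \<le> d \<Longrightarrow> a j \<in> U" "a d \<noteq> 0" "(\<Sum>j\<le>d. a j * x ^ j) \<in> p"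
    and g: "g \<in> frac_span T"
  shows "g * x ^ j \<in> frac_span ((\<lambda>(t, j). t * x ^ j) ` (T \<times> {..<d}))"
    (is "_ \<in> frac_span ?T'")
  using g
proof (induction arbitrary: j)
  case (base t)
  show ?case
  proof (induction j rule: less_induct)
    case (less j)
    show ?case
    proof (cases "j < d")
      case True
      then show ?thesis using base by (intro frac_span.base) force
    next
      case False
      \<comment> \<open>The relation is shifted so that its top term becomes
        \<open>a d * (t * x ^ j)\<close>; all other terms have smaller exponents and fall under the
        induction hypothesis.\<close>
      have "(t * x ^ (j - d)) * (\<Sum>l\<le>d. a l * x ^ l) = (\<Sum>l\<le>d. a l * (t * x ^ (j - d + l)))"
        by (simp add: sum_distrib_left power_add mult_ac)
      also have "\<dots> = (\<Sum>l<d. a l * (t * x ^ (j - d + l))) + a d * (t * x ^ j)"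
        using False by (simp add: lessThan_Suc_atMost[symmetric])
      finally have "a d * (t * x ^ j) =
          (t * x ^ (j - d)) * (\<Sum>l\<le>d. a l * x ^ l) + (- 1) * (\<Sum>l<d. a l * (t * x ^ (j - d + l)))"
        by simp
      also have "\<dots> \<in> frac_span ?T'"
      proof (rule frac_span.add)
        show "(t * x ^ (j - d)) * (\<Sum>l\<le>d. a l * x ^ l) \<in> frac_span ?T'"
          using a T base x by (intro frac_span.prime p_mult R_mult R_power) auto
        have "a l * (t * x ^ (j - d + l)) \<in> frac_span ?T'" if "l < d" for l
          using a that False by (intro frac_span.scale less) auto
        then show "(- 1) * (\<Sum>l<d. a l * (t * x ^ (j - d + l))) \<in> frac_span ?T'"
          by (intro frac_span.scale[OF U_uminus[OF U_1]] frac_span_sum) simp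
      qed
      finally have "a d * (t * x ^ j) \<in> frac_span ?T'" .
      then show ?thesis
        using a T base x by (auto intro: frac_span.cancel[where u = "a d"] R_mult R_power)
    qed
  qed
next
  case (prime y)
  then show ?case using p_mult[of y "x ^ j"] R_power[OF x]
    by (auto intro: frac_span.prime simp: mult.commute)
next
  case (add y z)
  then show ?case by (auto intro: frac_span.add simp: algebra_simps)
next
  case (scale u y)
  then show ?case by (auto intro: frac_span.scale simp: mult.assoc)
next
  case (cancel u y)
  then show ?case
    using x R_mult R_power frac_span.cancel[of u "y * x ^ j"] by (simp add: mult.assoc)
qed

end

section \<open>Polynomials in a set of variables\<close>

text \<open>Nothing can cancel at a monomial that factors in only one way: once \<open>p\<close> and
  \<open>q\<close> lose their terms at \<open>a\<close> and \<open>b\<close>, only the product of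
  these two terms contributes at \<open>a + b\<close>.\<close>

lemma lookup_mult_unique:
  fixes p q :: "'a::cancel_comm_monoid_add \<Rightarrow>\<^sub>0 'k::comm_ring_1"
  assumes "\<And>c d. c \<in> Poly_Mapping.keys p \<Longrightarrow> d \<in> Poly_Mapping.keys q \<Longrightarrow> c + d = a + b \<Longrightarrow> c = a \<and> d = b"
  shows "Poly_Mapping.lookup (p * q) (a + b) = Poly_Mapping.lookup p a * Poly_Mapping.lookup q b"
proof -
  define p' where "p' = p - Poly_Mapping.single a (Poly_Mapping.lookup p a)"
  define q' where "q' = q - Poly_Mapping.single b (Poly_Mapping.lookup q b)"
  have keys: "Poly_Mapping.keys p' \<subseteq> Poly_Mapping.keys p - {a}"
    "Poly_Mapping.keys q' \<subseteq> Poly_Mapping.keys q - {b}"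
    by (auto simp: p'_def q'_def in_keys_iff lookup_minus lookup_single when_def split: if_splits)
  have "a + b \<notin> Poly_Mapping.keys (p' * q)"
    using keys_mult[of p' q] keys(1) assms by fastforce
  moreover have "a + b \<notin> Poly_Mapping.keys (Poly_Mapping.single a (Poly_Mapping.lookup p a) * q')"
    using keys_mult[of "Poly_Mapping.single a (Poly_Mapping.lookup p a)" q'] keys(2)
    by (fastforce split: if_splits)
  moreover have "p * q = p' * q + Poly_Mapping.single a (Poly_Mapping.lookup p a) * q' +
      Poly_Mapping.single (a + b) (Poly_Mapping.lookup p a * Poly_Mapping.lookup q b)"
    by (simp add: p'_def q'_def algebra_simps flip: mult_single)
  ultimately show ?thesis
    by (simp add: lookup_add in_keys_iff)
qed

text \<open>
  The library proves the absence of zero divisors only for linearly ordered variables, so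
  compare the monomials occurring in \<open>p\<close> and \<open>q\<close> by a weight \<open>w\<close> that separates them.
\<close>

lemma weight_mult_nonzero:
  fixes p q :: "'a::cancel_comm_monoid_add \<Rightarrow>\<^sub>0 'k::idom" and w :: "'a \<Rightarrow> nat"
  assumes "p \<noteq> 0" "q \<noteq> 0" and w: "\<And>a b. w (a + b) = w a + w b"
    and inj: "inj_on w (Poly_Mapping.keys p)" "inj_on w (Poly_Mapping.keys q)"
  shows "p * q \<noteq> 0"
proof -
  have "Poly_Mapping.keys p \<noteq> {}" "Poly_Mapping.keys q \<noteq> {}"
    using assms by (auto simp: poly_mapping_eq_iff in_keys_iff fun_eq_iff)
  then obtain a b where a: "a \<in> Poly_Mapping.keys p" "\<forall>c\<in>Poly_Mapping.keys p. w c \<le> w a"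
    and b: "b \<in> Poly_Mapping.keys q" "\<forall>c\<in>Poly_Mapping.keys q. w c \<le> w b"
    using Max_in[of "w ` Poly_Mapping.keys p"] Max_in[of "w ` Poly_Mapping.keys q"]
      Max_ge[of "w ` Poly_Mapping.keys p"] Max_ge[of "w ` Poly_Mapping.keys q"]
    by (smt (verit) finite_imageI finite_keys imageE image_eqI image_is_empty)
  have "c = a \<and> d = b"
    if cd: "c \<in> Poly_Mapping.keys p" "d \<in> Poly_Mapping.keys q" "c + d = a + b" for c d
  proof -
    have "w c + w d = w a + w b" "w c \<le> w a" "w d \<le> w b"
      using cd w a b by metis+
    then have "w c = w a" by simp
    then have "c = a" using inj(1) cd a by (auto dest: inj_onD)
    then show ?thesis using cd(3) by simp
  qed
  then have "Poly_Mapping.lookup (p * q) (a + b) \<noteq> 0"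
    using lookup_mult_unique[of p q a b] a b by (simp add: in_keys_iff)
  then show ?thesis by auto
qed

text \<open>Digit 0 is the residue modulo \<open>B\<close>; cancelling it and dividing by
  \<open>B\<close> shifts the remaining digits down.\<close>

lemma base_expansion_unique:
  fixes a b :: "nat \<Rightarrow> nat"
  assumes "\<And>i. i < n \<Longrightarrow> a i < B" "\<And>i. i < n \<Longrightarrow> b i < B"
    and "(\<Sum>i<n. a i * B ^ i) = (\<Sum>i<n. b i * B ^ i)" "i < n"
  shows "a i = b i"
  using assms
proof (induction n arbitrary: a b i)
  case 0
  then show ?case by simp
next
  case (Suc n)
  have *: "(\<Sum>i<Suc n. f i * B ^ i) = f 0 + B * (\<Sum>i<n. f (Suc i) * B ^ i)" for f :: "nat \<Rightarrow> nat"
    by (subst sum.lessThan_Suc_shift) (simp add: sum_distrib_left algebra_simps)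
  have eq: "a 0 + B * (\<Sum>i<n. a (Suc i) * B ^ i) = b 0 + B * (\<Sum>i<n. b (Suc i) * B ^ i)"
    using Suc.prems(3) unfolding * .
  have B: "a 0 < B" "b 0 < B" using Suc.prems by auto
  have 0: "a 0 = b 0"
    using arg_cong[OF eq, of "\<lambda>x. x mod B"] B by simp
  then have "(\<Sum>i<n. a (Suc i) * B ^ i) = (\<Sum>i<n. b (Suc i) * B ^ i)"
    using eq B by simp
  then have "a (Suc i) = b (Suc i)" if "i < n" for i
    using Suc.IH[of "\<lambda>i. a (Suc i)" "\<lambda>i. b (Suc i)" i] Suc.prems that by auto
  with 0 Suc.prems(4) show ?case by (cases i) auto
qed

text \<open>Kronecker substitution: an exponent vector is read as the digits of a number, in a base
  that exceeds every exponent occurring in \<open>M\<close>.\<close>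

lemma separating_weight:
  fixes M :: "('i \<Rightarrow>\<^sub>0 nat) set"
  assumes "finite M"
  shows "\<exists>w :: ('i \<Rightarrow>\<^sub>0 nat) \<Rightarrow> nat. (\<forall>a b. w (a + b) = w a + w b) \<and> inj_on w M"
proof -
  define V where "V = (\<Union>m\<in>M. Poly_Mapping.keys m)"
  define n where "n = card V"
  \<comment> \<open>A crude bound: the sum of all exponents in \<open>M\<close> dominates each of
    them, and \<open>Suc\<close> makes the inequality strict.\<close>
  define B where "B = Suc (\<Sum>m\<in>M. \<Sum>v\<in>V. Poly_Mapping.lookup m v)"
  have fin: "finite V" using assms by (auto simp: V_def)
  then obtain e where e: "bij_betw e {..<n} V"
    unfolding n_def using ex_bij_betw_nat_finite[of V] by (auto simp: atLeast0LessThan)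
  define w where "w m = (\<Sum>i<n. Poly_Mapping.lookup m (e i) * B ^ i)" for m
  have less: "Poly_Mapping.lookup m (e i) < B" if "m \<in> M" "i < n" for m i
  proof -
    have "e i \<in> V" using e that by (auto simp: bij_betw_def)
    then have "Poly_Mapping.lookup m (e i) \<le> (\<Sum>v\<in>V. Poly_Mapping.lookup m v)"
      using fin by (intro member_le_sum) auto
    also have "\<dots> \<le> (\<Sum>m\<in>M. \<Sum>v\<in>V. Poly_Mapping.lookup m v)"
      using assms that by (intro member_le_sum[where f = "\<lambda>m. \<Sum>v\<in>V. Poly_Mapping.lookup m v"]) auto
    finally show ?thesis by (simp add: B_def)
  qed
  have "inj_on w M"
  proof (rule inj_onI)
    fix a b assume ab: "a \<in> M" "b \<in> M" "w a = w b"
    have "Poly_Mapping.lookup a (e i) = Poly_Mapping.lookup b (e i)" if "i < n" for i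
      using base_expansion_unique[of n "\<lambda>i. Poly_Mapping.lookup a (e i)" B
          "\<lambda>i. Poly_Mapping.lookup b (e i)" i] less ab that by (auto simp: w_def)
    then have "Poly_Mapping.lookup a v = Poly_Mapping.lookup b v" if "v \<in> V" for v
      using that e by (force simp: bij_betw_def)
    moreover have "Poly_Mapping.lookup a v = 0" "Poly_Mapping.lookup b v = 0" if "v \<notin> V" for v
      using that ab by (auto simp: V_def in_keys_iff)
    ultimately show "a = b" by (metis poly_mapping_eqI)
  qed
  moreover have "w (a + b) = w a + w b" for a b
    by (simp add: w_def lookup_add sum.distrib algebra_simps)
  ultimately show ?thesis by blast
qed

text \<open>Needed for the primality of ideals generated by variables, whose quotients are again
  polynomial rings.\<close>

lemma mpoly_mult_eq_0_iff:
  fixes p q :: "('i, 'k::field) mpoly"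
  shows "p * q = 0 \<longleftrightarrow> p = 0 \<or> q = 0"
proof -
  have "finite (Poly_Mapping.keys p \<union> Poly_Mapping.keys q)" by simp
  then obtain w :: "('i \<Rightarrow>\<^sub>0 nat) \<Rightarrow> nat" where add: "\<forall>a b. w (a + b) = w a + w b"
    and inj: "inj_on w (Poly_Mapping.keys p \<union> Poly_Mapping.keys q)"
    using separating_weight by blast
  have "inj_on w (Poly_Mapping.keys p)" "inj_on w (Poly_Mapping.keys q)"
    using inj by (meson inj_on_subset sup_ge1 sup_ge2)+
  then show ?thesis
    using weight_mult_nonzero[of p q w] add by (metis mult_zero_left mult_zero_right)
qed

section \<open>Polynomials in a chosen set of variables, and prime ideals among them\<close>

abbreviation polys :: "'i set \<Rightarrow> ('i, 'k::field) mpoly set" where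
  "polys V \<equiv> carrier (polynomial_ring V)"

lemma mem_polys: "p \<in> polys V \<longleftrightarrow> (\<forall>m\<in>Poly_Mapping.keys p. Poly_Mapping.keys m \<subseteq> V)"
  by (simp add: polynomial_ring_def)

lemma polys_mono: "V \<subseteq> W \<Longrightarrow> polys V \<subseteq> polys W"
  unfolding mem_polys subset_iff by blast

lemma polys_0 [simp]: "0 \<in> polys V"
  and polys_1 [simp]: "1 \<in> polys V"
  by (auto simp: mem_polys)

lemma polys_single: "Poly_Mapping.keys m \<subseteq> V \<Longrightarrow> Poly_Mapping.single m c \<in> polys V"
  by (auto simp: mem_polys)

lemma polys_add: "p \<in> polys V \<Longrightarrow> q \<in> polys V \<Longrightarrow> p + q \<in> polys V"
  using keys_add[of p q] by (auto simp: mem_polys)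

lemma polys_uminus: "p \<in> polys V \<Longrightarrow> - p \<in> polys V"
  by (auto simp: mem_polys in_keys_iff)

lemma polys_mult: "p \<in> polys V \<Longrightarrow> q \<in> polys V \<Longrightarrow> p * q \<in> polys V"
proof -
  assume *: "p \<in> polys V" "q \<in> polys V"
  have "Poly_Mapping.keys m \<subseteq> V" if m: "m \<in> Poly_Mapping.keys (p * q)" for m
  proof -
    obtain a b where "m = a + b" "a \<in> Poly_Mapping.keys p" "b \<in> Poly_Mapping.keys q"
      using keys_mult[of p q] m by blast
    then show ?thesis using * keys_add[of a b] by (force simp: mem_polys)
  qed
  then show ?thesis by (simp add: mem_polys)
qed

lemma polys_sum: "(\<And>i. i \<in> I \<Longrightarrow> f i \<in> polys V) \<Longrightarrow> sum f I \<in> polys V"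
  by (induction I rule: infinite_finite_induct) (auto simp: polys_add)

lemma polys_prod: "(\<And>i. i \<in> I \<Longrightarrow> f i \<in> polys V) \<Longrightarrow> prod f I \<in> polys V"
  by (induction I rule: infinite_finite_induct) (auto simp: polys_mult)

lemma coord_polys: "i \<in> V \<Longrightarrow> coord i \<in> polys V"
  by (auto simp: coord_def intro: polys_single)

lemma coord_power: "coord i ^ n = Poly_Mapping.single (Poly_Mapping.single i n) 1"
  by (induction n) (auto simp: coord_def mult_single simp flip: single_add)

lemma sum_monomials: "p = (\<Sum>m\<in>Poly_Mapping.keys p. Poly_Mapping.single m (Poly_Mapping.lookup p m))"
  by (rule poly_mapping_eqI)
    (auto simp: lookup_sum lookup_single when_def in_keys_iff)

lemma polys_insert_expand:
  fixes p :: "('i, 'k::field) mpoly"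
  assumes p: "p \<in> polys (insert i V)"
  shows "\<exists>c n. (\<forall>j. c j \<in> polys V) \<and> (\<forall>j>n. c j = 0) \<and> p = (\<Sum>j\<le>n. c j * coord i ^ j)"
proof -
  \<comment> \<open>Coefficients are required to vanish beyond \<open>n\<close>, so that expansions
    of different lengths can be extended to a common length and added.\<close>
  define E where "E p c n \<longleftrightarrow> (\<forall>j. c j \<in> polys V) \<and> (\<forall>j>n. c j = 0) \<and>
    p = (\<Sum>j\<le>n. c j * coord i ^ j)" for p :: "('i, 'k) mpoly" and c and n :: nat
  have add: "E (f + g) (\<lambda>j. c j + d j) (max n l)" if "E f c n" "E g d l" for f g c d n l
  proof -
    have extend: "(\<Sum>j\<le>k. e j * coord i ^ j) = (\<Sum>j\<le>max n l. e j * coord i ^ j)"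
      if "\<forall>j>k. e j = 0" "k \<le> max n l" for e :: "nat \<Rightarrow> ('i, 'k) mpoly" and k
      using that by (intro sum.mono_neutral_left) auto
    have "f = (\<Sum>j\<le>max n l. c j * coord i ^ j)"
      using that(1) extend[of n c] by (simp add: E_def)
    moreover have "g = (\<Sum>j\<le>max n l. d j * coord i ^ j)"
      using that(2) extend[of l d] by (simp add: E_def)
    ultimately have "f + g = (\<Sum>j\<le>max n l. (c j + d j) * coord i ^ j)"
      by (simp add: algebra_simps sum.distrib)
    then show ?thesis
      using that unfolding E_def by (simp add: polys_add)
  qed
  have sum: "\<exists>c n. E (sum f M) c n" if "finite M" "\<And>m. m \<in> M \<Longrightarrow> \<exists>c n. E (f m) c n"
    for M :: "('i \<Rightarrow>\<^sub>0 nat) set" and f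
    using that
  proof (induction M rule: finite_induct)
    case empty
    have "E 0 (\<lambda>_. 0) 0" by (simp add: E_def)
    then show ?case unfolding sum.empty by (intro exI)
  next
    case (insert m M)
    obtain c n where c: "E (f m) c n" using insert.prems[OF insertI1] by (elim exE)
    have "\<exists>c n. E (sum f M) c n"
      using insert.prems by (intro insert.IH) simp
    then obtain d l where d: "E (sum f M) d l" by (elim exE)
    show ?case
      unfolding sum.insert[OF insert.hyps] by (intro exI) (rule add[OF c d])
  qed
  have single: "\<exists>c n. E (Poly_Mapping.single m a) c n"
    if "Poly_Mapping.keys m \<subseteq> insert i V" for m and a :: 'k
  proof -
    \<comment> \<open>The monomial \<open>m\<close> with its power of the variable \<open>i\<close>
      removed.\<close>
    define m' where "m' = Poly_Mapping.update i 0 m"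
    define n where "n = Poly_Mapping.lookup m i"
    have m: "m = m' + Poly_Mapping.single i n"
      by (rule poly_mapping_eqI)
        (simp add: m'_def n_def lookup_add lookup_update lookup_single when_def)
    have "Poly_Mapping.keys m' \<subseteq> V"
      using that by (auto simp: m'_def keys_update)
    moreover have "Poly_Mapping.single m a = Poly_Mapping.single m' a * coord i ^ n"
      by (simp add: coord_power mult_single m)
    moreover have "(\<Sum>j\<le>n. (if j = n then Poly_Mapping.single m' a else 0) * coord i ^ j) =
        Poly_Mapping.single m' a * coord i ^ n"
      by (simp add: if_distrib[of "\<lambda>x. x * _"] cong: if_cong)
    ultimately have "E (Poly_Mapping.single m a) (\<lambda>j. if j = n then Poly_Mapping.single m' a else 0) n"
      by (simp add: E_def polys_single)
    then show ?thesis by (intro exI)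
  qed
  have "\<exists>c n. E (\<Sum>m\<in>Poly_Mapping.keys p. Poly_Mapping.single m (Poly_Mapping.lookup p m)) c n"
    using p by (intro sum single) (auto simp: mem_polys)
  then show ?thesis unfolding E_def by (simp only: sum_monomials[symmetric])
qed

lemma cring_polynomial_ring: "cring (polynomial_ring V)"
proof (rule cringI)
  have *: "mult (polynomial_ring V) = (*)" "add (polynomial_ring V) = (+)"
    "one (polynomial_ring V) = 1" "zero (polynomial_ring V) = 0"
    by (simp_all add: polynomial_ring_def)
  show "abelian_group (polynomial_ring V)"
    by (rule abelian_groupI) (auto simp: * polys_add algebra_simps intro: bexI[OF _ polys_uminus])
  show "Group.comm_monoid (polynomial_ring V)"
    by (rule comm_monoidI) (auto simp: * polys_mult algebra_simps)
qed (simp add: polynomial_ring_def algebra_simps)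

text \<open>Translates the record-based notion into operations of the type. Commutativity makes
  one-sided absorption enough, and closure under negation is absorption of
  \<open>- 1\<close>.\<close>

lemma spec_polynomial_ring_iff:
  fixes P :: "('i, 'k::field) mpoly set"
  shows "P \<in> spec (polynomial_ring V) \<longleftrightarrow>
    P \<subseteq> polys V \<and> 0 \<in> P \<and> 1 \<notin> P \<and> (\<forall>a\<in>P. \<forall>b\<in>P. a + b \<in> P) \<and>
    (\<forall>a\<in>P. \<forall>x\<in>polys V. x * a \<in> P) \<and>
    (\<forall>a\<in>polys V. \<forall>b\<in>polys V. a * b \<in> P \<longrightarrow> a \<in> P \<or> b \<in> P)" (is "_ \<longleftrightarrow> ?rhs")
proof
  let ?R = "polynomial_ring V :: ('i, 'k) mpoly ring"
  have *: "mult ?R = (*)" "add ?R = (+)" "one ?R = 1" "zero ?R = 0"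
    by (simp_all add: polynomial_ring_def)
  {
    assume "P \<in> spec ?R"
    then interpret primeideal P ?R by (simp add: spec_def)
    have "P \<subseteq> polys V" by (rule a_subset)
    moreover have "0 \<in> P" using additive_subgroup.zero_closed[OF is_additive_subgroup] by (simp add: *)
    moreover have "1 \<notin> P" using I_notcarr one_imp_carrier by (auto simp: *)
    moreover have "\<forall>a\<in>P. \<forall>b\<in>P. a + b \<in> P"
      using additive_subgroup.a_closed[OF is_additive_subgroup] unfolding * by blast
    moreover have "\<forall>a\<in>P. \<forall>x\<in>polys V. x * a \<in> P" using I_l_closed unfolding * by blast
    moreover have "\<forall>a\<in>polys V. \<forall>b\<in>polys V. a * b \<in> P \<longrightarrow> a \<in> P \<or> b \<in> P"
      using I_prime unfolding * by blast
    ultimately show ?rhs by blast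
  next
    assume P: ?rhs
    have inv: "- a \<in> P" if "a \<in> P" for a
    proof -
      have "(- 1) * a \<in> P" using P that polys_uminus[OF polys_1] by blast
      then show ?thesis by simp
    qed
    interpret cring ?R by (rule cring_polynomial_ring)
    have minv: "inv\<^bsub>add_monoid ?R\<^esub> a \<in> P" if "a \<in> P" for a
    proof -
      have "a \<in> polys V" using P that by blast
      then have "\<ominus>\<^bsub>?R\<^esub> a = - a"
        by (intro minus_equality) (auto simp: * polys_uminus)
      then show ?thesis using inv that by (simp add: a_inv_def)
    qed
    have "primeideal P ?R"
    proof (rule primeidealI2)
      show "additive_subgroup P ?R"
        by (intro additive_subgroupI subgroup.intro) (use P minv in \<open>auto simp: *\<close>)
      show "cring ?R" by (rule cring_polynomial_ring)
      show "polys V \<noteq> P" using P polys_1 by metis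
      fix a x :: "('i, 'k) mpoly" assume ax: "a \<in> P" "x \<in> polys V"
      then have "x * a \<in> P" using P by blast
      then show "x \<otimes>\<^bsub>?R\<^esub> a \<in> P" "a \<otimes>\<^bsub>?R\<^esub> x \<in> P"
        by (simp_all add: * mult.commute)
    next
      fix a b :: "('i, 'k) mpoly" assume "a \<in> polys V" "b \<in> polys V" "a \<otimes>\<^bsub>?R\<^esub> b \<in> P"
      then show "a \<in> P \<or> b \<in> P" using P unfolding * by blast
    qed
    then show "P \<in> spec ?R" by (simp add: spec_def)
  }
qed

section \<open>Heights of coordinate primes\<close>

text \<open>Algebraic independence of the classes of the variables \<open>S\<close>, phrased as
  injectivity of k[S] \<rightarrow> k[I] / P.\<close>

definition independent_mod :: "'i set \<Rightarrow> ('i, 'k::field) mpoly set \<Rightarrow> bool" where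
  "independent_mod S P \<longleftrightarrow> (\<forall>f\<in>P \<inter> polys S. f = 0)"

text \<open>
  Transcendence degree drops strictly: otherwise every variable is algebraic over \<open>k[S]\<close> modulo
  \<open>P\<close>, hence so is some \<open>f \<in> Q - P\<close>, and the lowest nonzero coefficient of an algebraic
  relation for \<open>f\<close> lies in \<open>Q \<inter> k[S]\<close>.
\<close>

lemma independent_mod_smaller_prime:
  fixes P Q :: "('i, 'k::field) mpoly set"
  assumes fin: "finite I" and P: "P \<in> spec (polynomial_ring I)" and Q: "Q \<in> spec (polynomial_ring I)"
    and PQ: "P \<subset> Q" and S: "S \<subseteq> I" "independent_mod S Q"
  shows "\<exists>i\<in>I - S. independent_mod (insert i S) P"
proof (rule ccontr)
  assume contra: "\<not> ?thesis"
  note P' = P[unfolded spec_polynomial_ring_iff] and Q' = Q[unfolded spec_polynomial_ring_iff]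
  have ind: "a = 0" if "a \<in> polys S" "a \<in> Q" for a
    using S(2) that by (auto simp: independent_mod_def)
  \<comment> \<open>Independence is assumed modulo \<open>Q\<close>; it passes to the smaller prime
    \<open>P\<close>, where the linear algebra takes place.\<close>
  interpret subring_mod_prime "polys I" "polys S" P
  proof
    show "polys S \<subseteq> polys I" by (rule polys_mono) fact
    show "a = 0" if "a \<in> polys S" "a \<in> P" for a using ind that PQ by blast
  qed (use P' in \<open>blast intro: polys_1 polys_add polys_mult polys_uminus\<close>)+
  have algebraic: "\<exists>d a. (\<forall>j\<le>d. a j \<in> polys S) \<and> a d \<noteq> 0 \<and> (\<Sum>j\<le>d. a j * coord i ^ j) \<in> P"
    if i: "i \<in> I - S" for i
  proof -
    obtain f where f: "f \<in> P" "f \<in> polys (insert i S)" "f \<noteq> 0"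
      using contra i by (auto simp: independent_mod_def)
    obtain c n where c: "\<forall>j. c j \<in> polys S" "\<forall>j>n. c j = 0" "f = (\<Sum>j\<le>n. c j * coord i ^ j)"
      using polys_insert_expand[OF f(2)] by blast
    \<comment> \<open>The bound \<open>n\<close> may exceed the degree; the largest index in
      \<open>?J\<close> gives a relation with nonzero leading coefficient.\<close>
    let ?J = "{j. j \<le> n \<and> c j \<noteq> 0}"
    have "?J \<noteq> {}"
    proof
      assume "?J = {}"
      then have "\<forall>j\<le>n. c j = 0" by blast
      then show False using c(3) f(3) by simp
    qed
    then have d: "Max ?J \<in> ?J" by (intro Max_in) auto
    have "f = (\<Sum>j\<le>Max ?J. c j * coord i ^ j)"
      unfolding c(3) using d Max_ge[of ?J] by (intro sum.mono_neutral_right) fastforce+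
    then show ?thesis using c f d by (intro exI[of _ "Max ?J"] exI[of _ c]) auto
  qed
  \<comment> \<open>All of k[I] / P is finite-dimensional over the fractions of k[S]: the variables
    are adjoined one at a time, each being algebraic.\<close>
  have cover: "\<exists>T. finite T \<and> T \<subseteq> polys I \<and> polys (S \<union> W) \<subseteq> frac_span T"
    if "finite W" "W \<subseteq> I" for W
    using that
  proof (induction W rule: finite_induct)
    case empty
    have "u \<in> frac_span {1}" if "u \<in> polys S" for u
      using frac_span.scale[OF that frac_span.base[of 1 "{1}"]] by simp
    then show ?case by (intro exI[of _ "{1}"]) (auto simp: R_1)
  next
    case (insert i W)
    then obtain T where T: "finite T" "T \<subseteq> polys I" "polys (S \<union> W) \<subseteq> frac_span T" by auto
    show ?case
    proof (cases "i \<in> S")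
      case True
      then have "S \<union> insert i W = S \<union> W" by auto
      with T show ?thesis by auto
    next
      case False
      then obtain d a where a: "\<forall>j\<le>d. a j \<in> polys S" "a d \<noteq> 0" "(\<Sum>j\<le>d. a j * coord i ^ j) \<in> P"
        using algebraic[of i] insert.prems by blast
      define T' :: "('i, 'k) mpoly set" where "T' = (\<lambda>(t, j). t * coord i ^ j) ` (T \<times> {..<d})"
      have i: "coord i \<in> polys I" using insert.prems by (intro coord_polys) simp
      have "f \<in> frac_span T'" if f: "f \<in> polys (S \<union> insert i W)" for f
      proof -
        have "f \<in> polys (insert i (S \<union> W))" using f by simp
        then obtain c n where c: "\<forall>j. c j \<in> polys (S \<union> W)" "f = (\<Sum>j\<le>n. c j * coord i ^ j)"
          using polys_insert_expand[of f i "S \<union> W"] by blast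
        have "c j * coord i ^ j \<in> frac_span T'" for j
          unfolding T'_def using a c T by (intro frac_span_adjoin[OF i, where a = a]) auto
        then show ?thesis unfolding c(2) by (rule frac_span_sum)
      qed
      moreover have "finite T'" "T' \<subseteq> polys I"
        using T i by (auto simp: T'_def intro!: R_mult R_power)
      ultimately show ?thesis by blast
    qed
  qed
  obtain T where T: "finite T" "T \<subseteq> polys I" "polys I \<subseteq> frac_span T"
    using cover[OF fin] S(1) by (auto simp: Un_absorb1)
  obtain f where f: "f \<in> Q" "f \<notin> P" using PQ by blast
  then have fI: "f \<in> polys I" using Q' by blast
  have power: "f ^ j \<in> frac_span T" for j using T(3) R_power[OF fI] by blast
  obtain b where b: "\<forall>j\<le>card T. b j \<in> polys S" "\<exists>j\<le>card T. b j \<noteq> 0" "(\<Sum>j\<le>card T. b j * f ^ j) \<in> P"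
    using frac_span_dependent[OF T(1,2), of "\<lambda>j. f ^ j", OF power] by (rule exE) blast
  define l where "l = (LEAST j. j \<le> card T \<and> b j \<noteq> 0)"
  have "l \<le> card T \<and> b l \<noteq> 0" unfolding l_def by (rule LeastI_ex) (rule b(2))
  then have l: "l \<le> card T" "b l \<noteq> 0" by simp_all
  have l_le: "b j = 0" if "j < l" "j \<le> card T" for j
    using not_less_Least[OF that(1)[unfolded l_def]] that(2) by simp
  define g where "g = (\<Sum>j=Suc l..card T. b j * f ^ (j - Suc l))"
  have gI: "g \<in> polys I"
    unfolding g_def using b U_sub by (intro R_sum R_mult R_power fI) auto
  have "(\<Sum>j\<le>card T. b j * f ^ j) = (\<Sum>j=l..card T. b j * f ^ j)"
    using l_le by (intro sum.mono_neutral_right) auto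
  also have "\<dots> = b l * f ^ l + (\<Sum>j=Suc l..card T. b j * f ^ j)"
    by (rule sum.atLeast_Suc_atMost) (rule l)
  also have "(\<Sum>j=Suc l..card T. b j * f ^ j) = f ^ l * (f * g)"
  proof -
    have "b j * f ^ j = f ^ l * (f * (b j * f ^ (j - Suc l)))" if "Suc l \<le> j" for j
    proof -
      have "f ^ j = f ^ l * (f * f ^ (j - Suc l))"
        using that by (simp flip: power_Suc power_add)
      then show ?thesis by (simp only: mult_ac)
    qed
    then show ?thesis by (simp add: g_def sum_distrib_left)
  qed
  \<comment> \<open>Since \<open>f\<close> is not in \<open>P\<close>, primality removes
    \<open>f ^ l\<close>. What remains lies in \<open>P\<close>, hence in \<open>Q\<close>, and
    subtracting the multiple \<open>f * g\<close> of \<open>f \<in> Q\<close> isolates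
    \<open>b l\<close>.\<close>
  finally have "f ^ l * (b l + f * g) \<in> P"
    using b(3) by (simp add: algebra_simps)
  moreover have "b l \<in> polys I" using b l U_sub by blast
  ultimately have "f ^ l \<in> P \<or> b l + f * g \<in> P"
    by (intro p_prime R_power R_add R_mult fI gI)
  then have "b l + f * g \<in> Q"
    using p_power[OF fI] f PQ by blast
  moreover have "(- g) * f \<in> Q"
    using Q' f(1) polys_uminus[OF gI] by blast
  ultimately have "(b l + f * g) + (- g) * f \<in> Q"
    using Q' by blast
  then have "b l \<in> Q" by (simp add: algebra_simps)
  then show False using ind[of "b l"] b l by blast
qed

text \<open>The chain descends from its largest prime \<open>P 0\<close>, the one modulo which an
  independent set is given; every step down contributes one more variable.\<close>

lemma prime_chain_length_le:
  fixes P :: "nat \<Rightarrow> ('i, 'k::field) mpoly set"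
  assumes fin: "finite I" and P: "\<And>i. i \<le> n \<Longrightarrow> P i \<in> spec (polynomial_ring I)"
    and dec: "\<And>i. i < n \<Longrightarrow> P (Suc i) \<subset> P i" and S: "S \<subseteq> I" "independent_mod S (P 0)"
  shows "card S + n \<le> card I"
proof -
  have "\<exists>S'\<subseteq>I. card S' = card S + m \<and> independent_mod S' (P m)" if "m \<le> n" for m
    using that
  proof (induction m)
    case 0
    then show ?case using S by auto
  next
    case (Suc m)
    then obtain S' where S': "S' \<subseteq> I" "card S' = card S + m" "independent_mod S' (P m)" by auto
    moreover obtain i where "i \<in> I - S'" "independent_mod (insert i S') (P (Suc m))"
      using independent_mod_smaller_prime[OF fin P P dec S'(1,3)] Suc.prems by auto
    moreover have "finite S'" using S' fin finite_subset by blast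
    ultimately show ?case by (intro exI[of _ "insert i S'"]) auto
  qed
  then obtain S' where "S' \<subseteq> I" "card S' = card S + n" by blast
  then show ?thesis using card_mono[OF fin, of S'] by simp
qed

text \<open>The ideal generated by the variables in \<open>C\<close>, described through supports so
  that membership is decided monomial by monomial.\<close>

definition coord_prime :: "'i set \<Rightarrow> 'i set \<Rightarrow> ('i, 'k::field) mpoly set" where
  "coord_prime I C = {p \<in> polys I. \<forall>m\<in>Poly_Mapping.keys p. Poly_Mapping.keys m \<inter> C \<noteq> {}}"

lemma coord_prime_independent: "independent_mod (I - C) (coord_prime I C)"
proof -
  have "f = 0" if "f \<in> coord_prime I C" "f \<in> polys (I - C)" for f
  proof -
    have "Poly_Mapping.keys f = {}"
      using that by (fastforce simp: coord_prime_def mem_polys)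
    then show ?thesis using sum_monomials[of f] by simp
  qed
  then show ?thesis by (auto simp: independent_mod_def)
qed

lemma coord_prime_add:
  "a \<in> coord_prime I C \<Longrightarrow> b \<in> coord_prime I C \<Longrightarrow> a + b \<in> coord_prime I C"
  using keys_add[of a b] polys_add[of a I b] unfolding coord_prime_def by blast

lemma coord_prime_mult:
  assumes "a \<in> coord_prime I C" "x \<in> polys I"
  shows "x * a \<in> coord_prime I C"
proof -
  have "Poly_Mapping.keys m \<inter> C \<noteq> {}" if m: "m \<in> Poly_Mapping.keys (x * a)" for m
  proof -
    obtain k l where kl: "m = k + l" "k \<in> Poly_Mapping.keys x" "l \<in> Poly_Mapping.keys a"
      using keys_mult[of x a] m by blast
    then obtain i where "i \<in> Poly_Mapping.keys l" "i \<in> C"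
      using assms by (auto simp: coord_prime_def)
    then have "i \<in> Poly_Mapping.keys m" using kl by (simp add: in_keys_iff lookup_add)
    then show ?thesis using \<open>i \<in> C\<close> by blast
  qed
  then show ?thesis using assms polys_mult by (auto simp: coord_prime_def)
qed

text \<open>The remainder is the result of substituting 0 for the variables in \<open>C\<close>: it
  keeps exactly the monomials avoiding \<open>C\<close>.\<close>

lemma coord_prime_remainder:
  assumes p: "p \<in> polys I"
  shows "\<exists>r\<in>polys (I - C). p - r \<in> coord_prime I C"
proof -
  let ?M = "{m \<in> Poly_Mapping.keys p. Poly_Mapping.keys m \<inter> C = {}}"
  define r where "r = (\<Sum>m\<in>?M. Poly_Mapping.single m (Poly_Mapping.lookup p m))"
  have r: "Poly_Mapping.lookup r m = (if m \<in> ?M then Poly_Mapping.lookup p m else 0)" for m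
    by (auto simp: r_def lookup_sum lookup_single when_def)
  have "r \<in> polys (I - C)"
    unfolding r_def using p by (intro polys_sum polys_single) (auto simp: mem_polys)
  moreover have "p - r \<in> coord_prime I C"
    using p by (auto simp: coord_prime_def mem_polys in_keys_iff lookup_minus r split: if_splits)
  ultimately show ?thesis by blast
qed

text \<open>The quotient is the polynomial ring in the variables \<open>I - C\<close>, a domain; the
  remainders \<open>r\<close> and \<open>s\<close> stand for the classes of \<open>a\<close> and
  \<open>b\<close>.\<close>

lemma coord_prime_in_spec:
  "(coord_prime I C :: ('i, 'k::field) mpoly set) \<in> spec (polynomial_ring I)"
proof -
  let ?P = "coord_prime I C :: ('i, 'k) mpoly set"
  have ind: "f = 0" if "f \<in> ?P" "f \<in> polys (I - C)" for f
    using coord_prime_independent[of I C] that by (auto simp: independent_mod_def)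
  have minus: "a - b \<in> ?P" if "a \<in> ?P" "b \<in> ?P" for a b
    using coord_prime_add[OF that(1) coord_prime_mult[OF that(2) polys_uminus[OF polys_1]]] by simp
  have prime: "a \<in> ?P \<or> b \<in> ?P" if ab: "a \<in> polys I" "b \<in> polys I" "a * b \<in> ?P" for a b
  proof -
    obtain r where r: "r \<in> polys (I - C)" "a - r \<in> ?P"
      using coord_prime_remainder[OF ab(1)] by blast
    obtain s where s: "s \<in> polys (I - C)" "b - s \<in> ?P"
      using coord_prime_remainder[OF ab(2)] by blast
    have rI: "r \<in> polys I" using r polys_mono[of "I - C" I] by blast
    have "b * (a - r) \<in> ?P" "r * (b - s) \<in> ?P"
      using r s rI ab by (auto intro: coord_prime_mult)
    \<comment> \<open>This combination equals \<open>r * s\<close>, which involves only variables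
      outside \<open>C\<close> and so must be 0.\<close>
    then have "a * b - b * (a - r) - r * (b - s) \<in> ?P"
      using ab(3) by (intro minus)
    then have "r * s \<in> ?P" by (simp add: algebra_simps)
    then have "r = 0 \<or> s = 0"
      using ind[of "r * s"] r s polys_mult mpoly_mult_eq_0_iff by blast
    then show ?thesis using r s by auto
  qed
  have "1 \<notin> ?P" "0 \<in> ?P" "?P \<subseteq> polys I"
    by (auto simp: coord_prime_def)
  then show ?thesis
    unfolding spec_polynomial_ring_iff
    by (intro conjI ballI impI) (auto intro: coord_prime_add coord_prime_mult dest: prime)
qed

lemma coord_mem_coord_prime: "i \<in> I \<Longrightarrow> coord i \<in> coord_prime I C \<longleftrightarrow> i \<in> C"
  using coord_polys[of i I] by (auto simp: coord_prime_def coord_def)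

text \<open>Every term of a polynomial in \<open>coord_prime I C\<close> is a multiple of some
  variable in \<open>C\<close>, so the variables generate.\<close>

lemma coord_prime_subset_iff:
  fixes Q :: "('i, 'k::field) mpoly set"
  assumes Q: "Q \<in> spec (polynomial_ring I)" and C: "C \<subseteq> I"
  shows "coord_prime I C \<subseteq> Q \<longleftrightarrow> coord ` C \<subseteq> Q"
proof
  assume "coord_prime I C \<subseteq> Q"
  then show "coord ` C \<subseteq> Q" using C coord_mem_coord_prime[of _ I C] by blast
next
  assume sub: "coord ` C \<subseteq> Q"
  note Q' = Q[unfolded spec_polynomial_ring_iff]
  have sum: "sum f M \<in> Q" if "\<And>m. m \<in> M \<Longrightarrow> f m \<in> Q" for f and M :: "('i \<Rightarrow>\<^sub>0 nat) set"
    using that by (induction M rule: infinite_finite_induct) (use Q' in auto)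
  show "coord_prime I C \<subseteq> Q"
  proof
    fix p :: "('i, 'k) mpoly" assume p: "p \<in> coord_prime I C"
    have "Poly_Mapping.single m (Poly_Mapping.lookup p m) \<in> Q" if m: "m \<in> Poly_Mapping.keys p" for m
    proof -
      obtain i where i: "i \<in> Poly_Mapping.keys m" "i \<in> C"
        using p m by (auto simp: coord_prime_def)
      \<comment> \<open>The truncated subtraction of exponents is exact, because \<open>i\<close>
        occurs in \<open>m\<close>.\<close>
      define m' where "m' = m - Poly_Mapping.single i 1"
      have "m = m' + Poly_Mapping.single i 1"
        using i by (intro poly_mapping_eqI)
          (auto simp: m'_def lookup_add lookup_minus lookup_single when_def in_keys_iff)
      then have "Poly_Mapping.single m (Poly_Mapping.lookup p m) =
          Poly_Mapping.single m' (Poly_Mapping.lookup p m) * coord i"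
        by (simp add: coord_def mult_single)
      moreover have "Poly_Mapping.keys m' \<subseteq> Poly_Mapping.keys m"
        by (auto simp: m'_def in_keys_iff lookup_minus)
      then have "Poly_Mapping.single m' (Poly_Mapping.lookup p m) \<in> polys I"
        using p m by (intro polys_single) (auto simp: coord_prime_def mem_polys)
      ultimately show ?thesis using Q' sub i by auto
    qed
    then show "p \<in> Q" using sum sum_monomials[of p] by metis
  qed
qed

section \<open>Irreducible closed sets and codimension\<close>

lemma irreducible_subset_Union:
  assumes "finite F" "\<And>Y. Y \<in> F \<Longrightarrow> closedin X Y" "irreducible_subset X Y" "Y \<subseteq> \<Union>F"
  shows "\<exists>Y'\<in>F. Y \<subseteq> Y'"
  using assms
proof (induction F rule: finite_induct)
  case empty
  then show ?case by (auto simp: irreducible_subset_def)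
next
  case (insert Z F)
  then have "closedin X Z" "closedin X (\<Union>F)" "Y \<subseteq> Z \<union> \<Union>F" by (auto intro: closedin_Union)
  then have "Y \<subseteq> Z \<or> Y \<subseteq> \<Union>F" using insert.prems(2) unfolding irreducible_subset_def by blast
  then show ?case using insert by blast
qed

text \<open>An irreducible subset of the union lies in a single member, so maximal ones are members;
  incomparability makes every member maximal.\<close>

lemma components_of_finite_Union:
  assumes fin: "finite F" and closed: "\<And>Y. Y \<in> F \<Longrightarrow> closedin X Y"
    and irr: "\<And>Y. Y \<in> F \<Longrightarrow> irreducible_subset X Y"
    and antichain: "\<And>Y Y'. Y \<in> F \<Longrightarrow> Y' \<in> F \<Longrightarrow> Y \<subseteq> Y' \<Longrightarrow> Y = Y'"
  shows "components_of_subset X (\<Union>F) = F"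
proof (intro equalityI subsetI)
  fix Y assume "Y \<in> components_of_subset X (\<Union>F)"
  then have Y: "irreducible_subset X Y" "Y \<subseteq> \<Union>F"
    and max: "\<And>Y'. irreducible_subset X Y' \<Longrightarrow> Y \<subseteq> Y' \<Longrightarrow> Y' \<subseteq> \<Union>F \<Longrightarrow> Y' = Y"
    unfolding components_of_subset_def by blast+
  obtain Y' where "Y' \<in> F" "Y \<subseteq> Y'" using irreducible_subset_Union[OF fin closed Y] by blast
  then show "Y \<in> F" using max[of Y'] irr by blast
next
  fix Y assume Y: "Y \<in> F"
  have "Y' = Y" if Y': "irreducible_subset X Y'" "Y \<subseteq> Y'" "Y' \<subseteq> \<Union>F" for Y'
  proof -
    obtain Z where "Z \<in> F" "Y' \<subseteq> Z" using irreducible_subset_Union[OF fin closed Y'(1,3)] by blast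
    then show ?thesis using antichain[OF Y, of Z] Y'(2) by blast
  qed
  then show "Y \<in> components_of_subset X (\<Union>F)"
    using Y irr unfolding components_of_subset_def by blast
qed

section \<open>Prime spectra and the Zariski topology\<close>

lemma specD:
  assumes "P \<in> spec R"
  shows "P \<subseteq> carrier R" "\<one>\<^bsub>R\<^esub> \<notin> P"
    "\<And>a b. a \<in> carrier R \<Longrightarrow> b \<in> carrier R \<Longrightarrow> a \<otimes>\<^bsub>R\<^esub> b \<in> P \<longleftrightarrow> a \<in> P \<or> b \<in> P"
proof -
  interpret primeideal P R using assms by (simp add: spec_def)
  show "P \<subseteq> carrier R" by (rule a_subset)
  show "\<one>\<^bsub>R\<^esub> \<notin> P" using I_notcarr one_imp_carrier by blast
  show "a \<otimes>\<^bsub>R\<^esub> b \<in> P \<longleftrightarrow> a \<in> P \<or> b \<in> P" if "a \<in> carrier R" "b \<in> carrier R" for a b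
    using that I_prime[of a b] I_l_closed[of b a] I_r_closed[of a b] by blast
qed

text \<open>The distinguished open set of 1 is already the whole spectrum.\<close>

lemma topspace_zariski:
  assumes "cring R"
  shows "topspace (zariski R) = spec R"
proof -
  interpret cring R by fact
  have "P \<in> (\<Union>f\<in>carrier R. {P \<in> spec R. f \<notin> P})" if "P \<in> spec R" for P
    using specD(2)[OF that] that by blast
  then show ?thesis unfolding zariski_def topology_generated_by_topspace by blast
qed

text \<open>Complements of zero loci survive the operations that generate the topology: unions of
  open sets correspond to unions of equation sets, binary intersections to products of
  equations.\<close>

lemma openin_zariski:
  assumes R: "cring R"
  shows "openin (zariski R) U \<longleftrightarrow> (\<exists>E\<subseteq>carrier R. U = spec R - zero_locus R E)"
proof
  interpret cring R by fact
  assume "openin (zariski R) U"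
  then have "generate_topology_on ((\<lambda>f. {P \<in> spec R. f \<notin> P}) ` carrier R) U"
    unfolding zariski_def openin_topology_generated_by_iff .
  then show "\<exists>E\<subseteq>carrier R. U = spec R - zero_locus R E"
  proof induction
    case Empty
    show ?case by (intro exI[of _ "{}"]) (auto simp: zero_locus_def)
  next
    case (Int U V)
    then obtain E F where E: "E \<subseteq> carrier R" "U = spec R - zero_locus R E"
      and F: "F \<subseteq> carrier R" "V = spec R - zero_locus R F" by blast
    \<comment> \<open>Pairwise products cut out the union of the two loci, because the points are
      prime ideals.\<close>
    let ?G = "{e \<otimes>\<^bsub>R\<^esub> f | e f. e \<in> E \<and> f \<in> F}"
    have "P \<in> zero_locus R ?G \<longleftrightarrow> P \<in> zero_locus R E \<or> P \<in> zero_locus R F" if P: "P \<in> spec R" for P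
    proof -
      have "e \<otimes>\<^bsub>R\<^esub> f \<in> P \<longleftrightarrow> e \<in> P \<or> f \<in> P" if "e \<in> E" "f \<in> F" for e f
        using specD(3)[OF P, of e f] that E F by blast
      then have "?G \<subseteq> P \<longleftrightarrow> E \<subseteq> P \<or> F \<subseteq> P" by blast
      then show ?thesis using P by (simp add: zero_locus_def)
    qed
    then have "U \<inter> V = spec R - zero_locus R ?G"
      unfolding E F by blast
    moreover have "?G \<subseteq> carrier R" using E F by auto
    ultimately show ?case by blast
  next
    case (UN K)
    then obtain E where E: "\<And>U. U \<in> K \<Longrightarrow> E U \<subseteq> carrier R \<and> U = spec R - zero_locus R (E U)" by metis
    have "\<Union>K = (\<Union>U\<in>K. spec R - zero_locus R (E U))" using E by auto
    also have "\<dots> = spec R - zero_locus R (\<Union>(E ` K))" by (auto simp: zero_locus_def)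
    finally show ?case using E by (intro exI[of _ "\<Union>(E ` K)"]) blast
  next
    case (Basis U)
    then obtain f where "f \<in> carrier R" "U = {P \<in> spec R. f \<notin> P}" by blast
    then show ?case by (intro exI[of _ "{f}"]) (auto simp: zero_locus_def)
  qed
next
  assume "\<exists>E\<subseteq>carrier R. U = spec R - zero_locus R E"
  then obtain E where E: "E \<subseteq> carrier R" "U = spec R - zero_locus R E" by blast
  then have "U = (\<Union>f\<in>E. {P \<in> spec R. f \<notin> P})" by (auto simp: zero_locus_def)
  moreover have "openin (zariski R) {P \<in> spec R. f \<notin> P}" if "f \<in> E" for f
    unfolding zariski_def using that E by (intro topology_generated_by_Basis) blast
  ultimately show "openin (zariski R) U" by auto
qed

lemma closedin_zariski:
  assumes "cring R"
  shows "closedin (zariski R) A \<longleftrightarrow> (\<exists>E\<subseteq>carrier R. A = zero_locus R E)"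
proof -
  have sub: "zero_locus R E \<subseteq> spec R" for E by (auto simp: zero_locus_def)
  have "closedin (zariski R) A \<longleftrightarrow> A \<subseteq> spec R \<and> (\<exists>E\<subseteq>carrier R. spec R - A = spec R - zero_locus R E)"
    by (simp add: closedin_def topspace_zariski[OF assms] openin_zariski[OF assms])
  also have "\<dots> \<longleftrightarrow> (\<exists>E\<subseteq>carrier R. A = zero_locus R E)"
    using sub by (metis double_diff order_refl)
  finally show ?thesis .
qed

lemma closedin_zero_locus: "cring R \<Longrightarrow> E \<subseteq> carrier R \<Longrightarrow> closedin (zariski R) (zero_locus R E)"
  using closedin_zariski by blast

text \<open>\<open>P\<close> is a generic point: a closed set containing it contains every prime
  above it.\<close>

lemma irreducible_zero_locus:
  assumes R: "cring R" and P: "P \<in> spec R"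
  shows "irreducible_subset (zariski R) (zero_locus R P)"
proof -
  have "zero_locus R P \<subseteq> A \<or> zero_locus R P \<subseteq> B"
    if AB: "closedin (zariski R) A" "closedin (zariski R) B" "zero_locus R P \<subseteq> A \<union> B" for A B
  proof -
    obtain E where E: "A = zero_locus R E" using AB(1) unfolding closedin_zariski[OF R] by blast
    obtain F where F: "B = zero_locus R F" using AB(2) unfolding closedin_zariski[OF R] by blast
    have "P \<in> zero_locus R P" using P by (simp add: zero_locus_def)
    then have "P \<in> A \<or> P \<in> B" using AB by blast
    then show ?thesis unfolding E F zero_locus_def by blast
  qed
  moreover have "zero_locus R P \<noteq> {}" "zero_locus R P \<subseteq> spec R"
    using P by (auto simp: zero_locus_def)
  ultimately show ?thesis
    unfolding irreducible_subset_def topspace_zariski[OF R] by blast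
qed

text \<open>\<open>\<Inter>W\<close> is the vanishing ideal of \<open>W\<close>. If it contains
  \<open>a * b\<close>, the loci of \<open>a\<close> and \<open>b\<close> cover \<open>W\<close>,
  and irreducibility selects one of them.\<close>

lemma irreducible_closed_prime:
  assumes R: "cring R" and closed: "closedin (zariski R) W" and irr: "irreducible_subset (zariski R) W"
  shows "\<Inter>W \<in> spec R" "W = zero_locus R (\<Inter>W)"
proof -
  interpret cring R by fact
  obtain E where E: "E \<subseteq> carrier R" "W = zero_locus R E"
    using closed unfolding closedin_zariski[OF R] by blast
  have W: "W \<subseteq> spec R" "W \<noteq> {}"
    using irr topspace_zariski[OF R] by (auto simp: irreducible_subset_def)
  show "W = zero_locus R (\<Inter>W)"
    using W E unfolding zero_locus_def by blast
  have ideals: "ideal P R" if "P \<in> W" for P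
    using W that by (auto simp: spec_def primeideal_def)
  have "primeideal (\<Inter>W) R"
  proof (rule primeidealI)
    show "ideal (\<Inter>W) R" using W ideals by (intro i_Intersect) auto
    show "cring R" by fact
    obtain P where P: "P \<in> W" using W by blast
    then have "P \<in> spec R" using W by blast
    then have "\<one>\<^bsub>R\<^esub> \<notin> P" by (rule specD(2))
    then show "carrier R \<noteq> \<Inter>W" using P one_closed by blast
  next
    fix a b assume ab: "a \<in> carrier R" "b \<in> carrier R" "a \<otimes>\<^bsub>R\<^esub> b \<in> \<Inter>W"
    have "W \<subseteq> zero_locus R {a} \<union> zero_locus R {b}"
    proof
      fix P assume P: "P \<in> W"
      then have "P \<in> spec R" "a \<otimes>\<^bsub>R\<^esub> b \<in> P" using W ab by blast+
      then have "a \<in> P \<or> b \<in> P" using specD(3)[OF _ ab(1,2)] by blast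
      then show "P \<in> zero_locus R {a} \<union> zero_locus R {b}"
        using \<open>P \<in> spec R\<close> by (simp add: zero_locus_def)
    qed
    moreover have "closedin (zariski R) (zero_locus R {a})" "closedin (zariski R) (zero_locus R {b})"
      using ab by (auto intro!: closedin_zero_locus[OF R])
    ultimately have "W \<subseteq> zero_locus R {a} \<or> W \<subseteq> zero_locus R {b}"
      using irr unfolding irreducible_subset_def by blast
    then show "a \<in> \<Inter>W \<or> b \<in> \<Inter>W" by (auto simp: zero_locus_def)
  qed
  then show "\<Inter>W \<in> spec R" by (simp add: spec_def)
qed

lemma Inter_zero_locus: "P \<in> spec R \<Longrightarrow> \<Inter>(zero_locus R P) = P"
  by (auto simp: zero_locus_def)

section \<open>Coordinate subspaces and their codimension\<close>

definition coord_locus :: "'i set \<Rightarrow> 'i set \<Rightarrow> ('i, 'k::field) mpoly set set" where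
  "coord_locus I C = zero_locus (polynomial_ring I) (coord ` C)"

lemma coord_locus_eq: "C \<subseteq> I \<Longrightarrow> coord_locus I C = zero_locus (polynomial_ring I) (coord_prime I C)"
  using coord_prime_subset_iff[of _ I C] unfolding coord_locus_def zero_locus_def by blast

lemma closedin_coord_locus: "C \<subseteq> I \<Longrightarrow> closedin (affine_space I) (coord_locus I C)"
  unfolding affine_space_def coord_locus_def
  by (rule closedin_zero_locus[OF cring_polynomial_ring]) (auto intro: coord_polys)

lemma irreducible_coord_locus: "C \<subseteq> I \<Longrightarrow> irreducible_subset (affine_space I) (coord_locus I C)"
  unfolding affine_space_def
  by (simp add: coord_locus_eq irreducible_zero_locus cring_polynomial_ring coord_prime_in_spec)

lemma coord_locus_subset_iff:
  assumes "C \<subseteq> I" "D \<subseteq> I"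
  shows "(coord_locus I C :: ('i, 'k::field) mpoly set set) \<subseteq> coord_locus I D \<longleftrightarrow> D \<subseteq> C"
proof
  assume sub: "(coord_locus I C :: ('i, 'k) mpoly set set) \<subseteq> coord_locus I D"
  \<comment> \<open>The generic point of the smaller locus decides the inclusion.\<close>
  have mem: "(coord_prime I C :: ('i, 'k) mpoly set) \<in> coord_locus I C"
    using assms coord_prime_in_spec by (simp add: coord_locus_eq zero_locus_def)
  have "coord ` D \<subseteq> (coord_prime I C :: ('i, 'k) mpoly set)"
    using subsetD[OF sub mem] by (simp add: coord_locus_def zero_locus_def)
  then show "D \<subseteq> C" using assms coord_mem_coord_prime[of _ I C] by blast
qed (auto simp: coord_locus_def zero_locus_def)

lemma coord_locus_Int: "coord_locus I C \<inter> coord_locus I D = coord_locus I (C \<union> D)"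
  by (auto simp: coord_locus_def zero_locus_def)

text \<open>Chains of closed sets going up from the locus are chains of primes going down from
  \<open>coord_prime I C\<close>, which bounds their length; releasing the equations one at a time
  attains the bound.\<close>

lemma codim_coord_locus:
  assumes fin: "finite I" and C: "C \<subseteq> I"
  shows "irreducible_codim (affine_space I) (coord_locus I C :: ('i, 'k::field) mpoly set set) =
    enat (card C)"
proof -
  let ?R = "polynomial_ring I :: ('i, 'k) mpoly ring"
  let ?A = "affine_space I :: ('i, 'k) mpoly set topology"
  define chain where "chain n W \<longleftrightarrow> W 0 = coord_locus I C \<and>
     (\<forall>i\<le>n. closedin ?A (W i) \<and> irreducible_subset ?A (W i)) \<and> (\<forall>i<n. W i \<subset> W (Suc i))" for n W
  have le: "n \<le> card C" if W: "chain n W" for n W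
  proof -
    have zariski: "?A = zariski ?R" by (simp add: affine_space_def)
    have spec: "\<Inter>(W i) \<in> spec ?R" "W i = zero_locus ?R (\<Inter>(W i))" if "i \<le> n" for i
      using irreducible_closed_prime[OF cring_polynomial_ring, of I "W i"] W that
      by (simp_all add: chain_def zariski)
    have dec: "\<Inter>(W (Suc i)) \<subset> \<Inter>(W i)" if "i < n" for i
    proof -
      have "W i \<subset> W (Suc i)" using W that by (simp add: chain_def)
      \<comment> \<open>A closed irreducible set is recovered from its prime, so strictness is
        preserved.\<close>
      moreover have "\<Inter>(W (Suc i)) \<noteq> \<Inter>(W i)"
        using spec(2)[of i] spec(2)[of "Suc i"] that calculation by fastforce
      ultimately show ?thesis by blast
    qed
    have "\<Inter>(W 0) = coord_prime I C"
      using W C by (simp add: chain_def coord_locus_eq Inter_zero_locus coord_prime_in_spec)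
    then have "card (I - C) + n \<le> card I"
      using prime_chain_length_le[OF fin, of n "\<lambda>i. \<Inter>(W i)" "I - C"] spec(1) dec
        coord_prime_independent[of I C] by auto
    moreover have "card (I - C) = card I - card C" "card C \<le> card I"
      using fin C by (simp_all add: card_Diff_subset finite_subset card_mono)
    ultimately show ?thesis by simp
  qed
  have "\<exists>W. chain (card C) W"
  proof -
    have "finite C" using fin C finite_subset by blast
    then obtain e where e: "bij_betw e {..<card C} C"
      using ex_bij_betw_nat_finite[of C] by (auto simp: atLeast0LessThan)
    \<comment> \<open>The equations left after the first \<open>i\<close> are dropped: all of
      \<open>C\<close> at \<open>i = 0\<close>, none at \<open>i = card C\<close>.\<close>
    define D where "D i = e ` {i..<card C}" for i
    have DI: "D i \<subseteq> I" for i using e C by (auto simp: D_def bij_betw_def)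
    have "\<not> D i \<subseteq> D (Suc i)" if "i < card C" for i
    proof -
      have "e i \<in> D i" using that by (simp add: D_def)
      moreover have "e i \<notin> D (Suc i)"
        using e that by (auto simp: D_def bij_betw_def dest!: inj_onD)
      ultimately show ?thesis by blast
    qed
    moreover have "D (Suc i) \<subseteq> D i" for i by (auto simp: D_def)
    ultimately have "(coord_locus I (D i) :: ('i, 'k) mpoly set set) \<subset> coord_locus I (D (Suc i))"
      if "i < card C" for i
      using that DI by (simp add: less_le_not_le coord_locus_subset_iff)
    moreover have "D 0 = C"
      using e by (simp add: D_def bij_betw_def atLeast0LessThan)
    ultimately have "chain (card C) (\<lambda>i. coord_locus I (D i))"
      using DI by (simp add: chain_def closedin_coord_locus irreducible_coord_locus)
    then show ?thesis by blast
  qed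
  then have "Sup {enat n |n. \<exists>W. chain n W} = enat (card C)"
    using le by (intro antisym Sup_least Sup_upper) auto
  then show ?thesis by (simp add: irreducible_codim_def chain_def)
qed

section \<open>Cones of a smooth fan\<close>

lemma convex_cone_hull_sum:
  "(\<And>i. i \<in> I \<Longrightarrow> f i \<in> convex_cone hull S) \<Longrightarrow> sum f I \<in> convex_cone hull S"
  by (induction I rule: infinite_finite_induct)
    (auto simp: convex_cone_hull_contains_0 convex_cone_hull_add)

text \<open>The cone and its generators have the same linear span. This shows that a smooth cone of
  dimension 1 has a single generator.\<close>

lemma dim_convex_cone_hull:
  assumes "independent G"
  shows "dim (convex_cone hull G) = card G"
proof -
  have "convex_cone hull G \<subseteq> span G"
    by (rule hull_minimal) (auto simp: span_superset convex_cone_span)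
  moreover have "G \<subseteq> span (convex_cone hull G)"
    using hull_subset[of G convex_cone] span_superset[of "convex_cone hull G"] by blast
  ultimately have "span (convex_cone hull G) = span G"
    by (simp add: span_eq)
  then show ?thesis
    using assms by (metis dim_span dim_eq_card_independent)
qed

text \<open>In the coordinates of \<open>B\<close> the cone is the face of the positive orthant on
  which the coordinates outside \<open>G\<close> vanish.\<close>

lemma mem_basis_cone_iff:
  fixes B :: "'v::real_vector set"
  assumes B: "finite B" "independent B" "span B = UNIV" and G: "G \<subseteq> B"
  shows "x \<in> convex_cone hull G \<longleftrightarrow>
    (\<forall>b. 0 \<le> representation B x b \<and> (b \<notin> G \<longrightarrow> representation B x b = 0))"
proof -
  let ?S = "{x. \<forall>b. 0 \<le> representation B x b \<and> (b \<notin> G \<longrightarrow> representation B x b = 0)}"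
  have "convex_cone ?S"
    using B by (auto simp: convex_cone_iff representation_add representation_scale representation_zero)
  moreover have "G \<subseteq> ?S"
    using B G by (auto simp: representation_basis)
  ultimately have "convex_cone hull G \<subseteq> ?S" by (intro hull_minimal)
  moreover have "x \<in> convex_cone hull G" if x: "x \<in> ?S"
  proof -
    have "x = (\<Sum>b\<in>B. representation B x b *\<^sub>R b)"
      using sum_representation_eq[of B x B] B by simp
    also have "\<dots> \<in> convex_cone hull G"
    proof (rule convex_cone_hull_sum)
      fix b assume "b \<in> B"
      show "representation B x b *\<^sub>R b \<in> convex_cone hull G"
      proof (cases "b \<in> G")
        case True
        then show ?thesis using x by (simp add: convex_cone_hull_mul hull_inc)
      next
        case False
        then show ?thesis using x by (auto simp: convex_cone_hull_contains_0)
      qed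
    qed
    finally show "x \<in> convex_cone hull G" .
  qed
  ultimately show ?thesis by blast
qed

text \<open>If a combination of two nonnegative numbers with positive weights vanishes, both numbers
  vanish; this is applied to each coordinate outside \<open>C\<close>.\<close>

lemma basis_cone_face:
  fixes B :: "'v::real_vector set"
  assumes B: "finite B" "independent B" "span B = UNIV" and G: "G \<subseteq> B" and C: "C \<subseteq> G"
  shows "convex_cone hull C face_of convex_cone hull G"
proof -
  note iff = mem_basis_cone_iff[OF B]
  have CB: "C \<subseteq> B" using C G by blast
  have "a \<in> convex_cone hull C \<and> b \<in> convex_cone hull C"
    if ab: "a \<in> convex_cone hull G" "b \<in> convex_cone hull G" and x: "x \<in> convex_cone hull C"
      and seg: "x \<in> open_segment a b" for a b x
  proof -
    obtain t where t: "0 < t" "t < 1" "x = (1 - t) *\<^sub>R a + t *\<^sub>R b"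
      using seg by (auto simp: in_segment)
    have "representation B a g = 0 \<and> representation B b g = 0" if "g \<notin> C" for g
    proof -
      have "representation B x g = 0" using x that iff[OF CB] by blast
      then have eq: "(1 - t) * representation B a g + t * representation B b g = 0"
        using B t by (simp add: representation_add representation_scale)
      moreover have "0 \<le> representation B a g" "0 \<le> representation B b g"
        using ab iff[OF G] by blast+
      ultimately show ?thesis
        using t by (smt (verit) mult_nonneg_nonneg mult_pos_pos)
    qed
    then show ?thesis using ab iff[OF G] iff[OF CB] by blast
  qed
  then show ?thesis
    unfolding face_of_def using hull_mono[OF C] convex_convex_cone_hull by blast
qed

section \<open>Lattice bases and primitive vectors\<close>

lemma lattice_basisD:
  assumes "lattice_basis L B"
  shows "finite B" "independent B" "span B = UNIV"
  using assms by (auto simp: lattice_basis_def)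

lemma representation_lattice_int:
  assumes B: "lattice_basis L B" and w: "w \<in> L"
  shows "\<exists>k::int. representation B w b = of_int k"
proof -
  note B' = lattice_basisD[OF B]
  obtain c where c: "w = (\<Sum>b\<in>B. of_int (c b) *\<^sub>R b)"
    using B w by (auto simp: lattice_basis_def)
  have "representation B w b = (\<Sum>b'\<in>B. of_int (c b') * representation B b' b)"
    unfolding c using B' by (simp add: representation_sum representation_scale)
  also have "\<dots> = (\<Sum>b'\<in>B. of_int (if b' = b then c b' else 0))"
    using B' by (intro sum.cong) (auto simp: representation_basis)
  also have "\<dots> = of_int (\<Sum>b'\<in>B. if b' = b then c b' else 0)"
    by simp
  finally show ?thesis by blast
qed

lemma basis_subset_lattice:
  assumes B: "lattice_basis L B" and b: "b \<in> B"
  shows "b \<in> L"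
proof -
  let ?c = "\<lambda>b'. if b' = b then 1 else 0 :: int"
  have "(\<Sum>b'\<in>B. of_int (?c b') *\<^sub>R b') = (\<Sum>b'\<in>B. if b' = b then b else 0)"
    by (rule sum.cong) auto
  then have "b = (\<Sum>b'\<in>B. of_int (?c b') *\<^sub>R b')"
    using lattice_basisD(1)[OF B] b by simp
  moreover have "L = {\<Sum>b\<in>B. of_int (c b) *\<^sub>R b | c. True}"
    using B by (simp add: lattice_basis_def)
  ultimately show ?thesis
    by (simp only: mem_Collect_eq) (intro exI[of _ ?c] conjI TrueI)
qed

text \<open>Comparing the \<open>b\<close>-coordinates in \<open>b = n w\<close> gives
  \<open>n * k = 1\<close> with \<open>k\<close> an integer.\<close>

lemma basis_primitive:
  assumes B: "lattice_basis L B" and b: "b \<in> B"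
  shows "primitive L b"
proof -
  note B' = lattice_basisD[OF B]
  have "\<bar>n\<bar> = 1" if w: "w \<in> L" "b = of_int n *\<^sub>R w" for w and n :: int
  proof -
    obtain k :: int where k: "representation B w b = of_int k"
      using representation_lattice_int[OF B w(1)] by blast
    have "1 = representation B b b" using B' b by (simp add: representation_basis)
    also have "\<dots> = of_int n * representation B w b"
      by (subst w(2)) (simp add: B' representation_scale)
    finally have "(of_int (n * k) :: real) = of_int 1" by (simp add: k)
    then have "n * k = 1" by (simp only: of_int_eq_iff)
    then show ?thesis by (auto simp: zmult_eq_1_iff)
  qed
  moreover have "b \<noteq> 0" using B' b dependent_zero by blast
  ultimately show ?thesis
    using basis_subset_lattice[OF B b] by (simp add: primitive_def)
qed

text \<open>A lattice vector on the ray is \<open>k b\<close> with an integer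
  \<open>k \<ge> 0\<close>, and primitivity leaves only \<open>k = 1\<close>. The generator of a ray
  thus does not depend on the chosen basis.\<close>

lemma primitive_in_basis_ray:
  assumes B: "lattice_basis L B" and b: "b \<in> B" and u: "primitive L u" "u \<in> convex_cone hull {b}"
  shows "u = b"
proof -
  note B' = lattice_basisD[OF B]
  have r: "0 \<le> representation B u b" "\<And>c. c \<noteq> b \<Longrightarrow> representation B u c = 0"
    using mem_basis_cone_iff[OF B', of "{b}" u] b u(2) by auto
  obtain k :: int where k: "representation B u b = of_int k"
    using representation_lattice_int[OF B, of u b] u by (auto simp: primitive_def)
  have "u = (\<Sum>c\<in>B. representation B u c *\<^sub>R c)"
    using sum_representation_eq[of B u B] B' by simp
  also have "\<dots> = (\<Sum>c\<in>B. if c = b then of_int k *\<^sub>R b else 0)"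
    using r k by (intro sum.cong) auto
  also have "\<dots> = of_int k *\<^sub>R b" using B' b by simp
  finally have eq: "u = of_int k *\<^sub>R b" .
  then have "\<bar>k\<bar> = 1" using u(1) basis_subset_lattice[OF B b] unfolding primitive_def by blast
  moreover have "0 \<le> k" using r(1) k by simp
  ultimately show ?thesis using eq by simp
qed

section \<open>Rays, primitive vectors and cones of a smooth fan\<close>

context
  fixes L :: "'v::real_vector set" and \<Sigma> :: "'v set set"
  assumes smooth: "smooth_fan L \<Sigma>"
begin

lemma smooth_cone:
  assumes "\<sigma> \<in> \<Sigma>"
  obtains B G where "lattice_basis L B" "G \<subseteq> B" "\<sigma> = convex_cone hull G"
  using smooth assms unfolding smooth_fan_def by blast

lemma fan_face: "\<sigma> \<in> \<Sigma> \<Longrightarrow> cone_face_of \<tau> \<sigma> \<Longrightarrow> \<tau> \<in> \<Sigma>"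
  using smooth unfolding smooth_fan_def fan_def by blast

lemma fan_cone_convex:
  assumes "\<sigma> \<in> \<Sigma>"
  shows "convex_cone \<sigma>"
  using smooth_cone[OF assms] convex_cone_convex_cone_hull by metis

text \<open>For \<tau> inside \<sigma> the intersection of the two is \<tau> itself, and the fan
  axioms make it a face.\<close>

lemma cone_face_iff_subset:
  assumes "\<tau> \<in> \<Sigma>" "\<sigma> \<in> \<Sigma>"
  shows "cone_face_of \<tau> \<sigma> \<longleftrightarrow> \<tau> \<subseteq> \<sigma>"
proof
  assume "\<tau> \<subseteq> \<sigma>"
  moreover have "cone_face_of (\<sigma> \<inter> \<tau>) \<sigma>"
    using smooth assms unfolding smooth_fan_def fan_def by blast
  ultimately show "cone_face_of \<tau> \<sigma>" by (simp add: inf_absorb2)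
qed (auto simp: cone_face_of_def face_of_imp_subset)

lemma smooth_ray:
  assumes "\<rho> \<in> fan_rays \<Sigma>"
  obtains B b where "lattice_basis L B" "b \<in> B" "\<rho> = convex_cone hull {b}"
proof -
  have \<rho>: "\<rho> \<in> \<Sigma>" "dim \<rho> = 1" using assms by (auto simp: fan_rays_def)
  obtain B G where B: "lattice_basis L B" "G \<subseteq> B" "\<rho> = convex_cone hull G"
    using smooth_cone[OF \<rho>(1)] .
  have "independent G" using independent_mono[OF lattice_basisD(2)[OF B(1)] B(2)] .
  then have "card G = 1" using dim_convex_cone_hull[of G] \<rho>(2) B(3) by simp
  then obtain b where "G = {b}" by (auto simp: card_1_singleton_iff)
  then show thesis using that B by blast
qed

lemma primitive_generator_unique:
  assumes "\<rho> \<in> fan_rays \<Sigma>" "primitive_generator L \<rho> u" "primitive_generator L \<rho> w"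
  shows "u = w"
proof -
  obtain B b where B: "lattice_basis L B" "b \<in> B" "\<rho> = convex_cone hull {b}"
    using smooth_ray[OF assms(1)] .
  have "v = b" if "primitive_generator L \<rho> v" for v
  proof (rule primitive_in_basis_ray[OF B(1,2)])
    show "primitive L v" using that by (simp add: primitive_generator_def)
    have "v \<in> \<rho>" using that hull_inc[of v "{v}" convex_cone] by (simp add: primitive_generator_def)
    then show "v \<in> convex_cone hull {b}" using B(3) by simp
  qed
  then show ?thesis using assms by blast
qed

lemma primitive_vector_ray:
  assumes "u \<in> primitive_vectors L \<Sigma>"
  shows "convex_cone hull {u} \<in> fan_rays \<Sigma>" "primitive_generator L (convex_cone hull {u}) u"
  using assms by (auto simp: primitive_vectors_def primitive_generator_def)

text \<open>Lets collections of vectors and sets of coordinates, which are indexed by rays, be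
  exchanged without changing cardinalities.\<close>

lemma bij_betw_primitive_vectors_rays:
  "bij_betw (\<lambda>u. convex_cone hull {u}) (primitive_vectors L \<Sigma>) (fan_rays \<Sigma>)"
  unfolding bij_betw_def
proof
  show "inj_on (\<lambda>u. convex_cone hull {u}) (primitive_vectors L \<Sigma>)"
  proof (rule inj_onI)
    fix u w assume uw: "u \<in> primitive_vectors L \<Sigma>" "w \<in> primitive_vectors L \<Sigma>"
      "convex_cone hull {u} = convex_cone hull {w}"
    show "u = w"
      using primitive_generator_unique[OF primitive_vector_ray(1,2)[OF uw(1)]]
        primitive_vector_ray(2)[OF uw(2)] uw(3) by simp
  qed
  have "\<rho> \<in> (\<lambda>u. convex_cone hull {u}) ` primitive_vectors L \<Sigma>" if \<rho>: "\<rho> \<in> fan_rays \<Sigma>" for \<rho>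
  proof -
    obtain B b where B: "lattice_basis L B" "b \<in> B" "\<rho> = convex_cone hull {b}"
      using smooth_ray[OF \<rho>] .
    then have "primitive_generator L \<rho> b"
      using basis_primitive by (simp add: primitive_generator_def)
    then have "b \<in> primitive_vectors L \<Sigma>" using \<rho> by (auto simp: primitive_vectors_def)
    then show ?thesis using B(3) by blast
  qed
  then show "(\<lambda>u. convex_cone hull {u}) ` primitive_vectors L \<Sigma> = fan_rays \<Sigma>"
    using primitive_vector_ray(1) by blast
qed

lemma finite_fan_rays: "finite (fan_rays \<Sigma>)"
  using smooth unfolding smooth_fan_def fan_def fan_rays_def by simp

lemma finite_primitive_vectors: "finite (primitive_vectors L \<Sigma>)"
  using bij_betw_finite[OF bij_betw_primitive_vectors_rays] finite_fan_rays by simp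

lemma cone_rays_iff:
  assumes "\<sigma> \<in> \<Sigma>" "u \<in> primitive_vectors L \<Sigma>"
  shows "convex_cone hull {u} \<in> cone_rays \<Sigma> \<sigma> \<longleftrightarrow> u \<in> \<sigma>"
proof -
  have "convex_cone hull {u} \<subseteq> \<sigma> \<longleftrightarrow> u \<in> \<sigma>"
    using hull_inc[of u "{u}" convex_cone] hull_minimal[of "{u}" \<sigma> convex_cone]
      fan_cone_convex[OF assms(1)] by blast
  moreover have "convex_cone hull {u} \<in> fan_rays \<Sigma>" by (rule primitive_vector_ray) fact
  moreover from this have "convex_cone hull {u} \<in> \<Sigma>" by (simp add: fan_rays_def)
  ultimately show ?thesis
    using cone_face_iff_subset[OF _ assms(1)] by (simp add: cone_rays_def)
qed

lemma primitive_generators_of_eq: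
  assumes "\<sigma> \<in> \<Sigma>"
  shows "primitive_generators_of L \<Sigma> \<sigma> = primitive_vectors L \<Sigma> \<inter> \<sigma>"
proof -
  have "u \<in> primitive_generators_of L \<Sigma> \<sigma> \<longleftrightarrow> u \<in> primitive_vectors L \<Sigma> \<and> u \<in> \<sigma>" for u
  proof
    assume "u \<in> primitive_generators_of L \<Sigma> \<sigma>"
    then obtain \<rho> where \<rho>: "\<rho> \<in> cone_rays \<Sigma> \<sigma>" "primitive_generator L \<rho> u"
      by (auto simp: primitive_generators_of_def)
    moreover have "u \<in> primitive_vectors L \<Sigma>"
      using \<rho> by (auto simp: primitive_vectors_def cone_rays_def)
    moreover have "\<rho> = convex_cone hull {u}" using \<rho> by (simp add: primitive_generator_def)
    ultimately show "u \<in> primitive_vectors L \<Sigma> \<and> u \<in> \<sigma>" using cone_rays_iff[OF assms] by simp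
  next
    assume u: "u \<in> primitive_vectors L \<Sigma> \<and> u \<in> \<sigma>"
    then have "convex_cone hull {u} \<in> cone_rays \<Sigma> \<sigma>" using cone_rays_iff[OF assms] by simp
    moreover have "primitive_generator L (convex_cone hull {u}) u"
      using u primitive_vector_ray(2) by blast
    ultimately show "u \<in> primitive_generators_of L \<Sigma> \<sigma>"
      unfolding primitive_generators_of_def by blast
  qed
  then show ?thesis by blast
qed

lemma part_of_cone_iff:
  "C \<subseteq> primitive_vectors L \<Sigma> \<Longrightarrow> part_of_cone L \<Sigma> C \<longleftrightarrow> (\<exists>\<sigma>\<in>\<Sigma>. C \<subseteq> \<sigma>)"
  unfolding part_of_cone_def using primitive_generators_of_eq by auto

text \<open>
  The ray of \<open>u\<close> is a face of the cone, so a basis vector with positive coefficient in \<open>u\<close>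
  lies on that ray.
\<close>

lemma primitive_vector_in_cone:
  assumes \<sigma>: "\<sigma> \<in> \<Sigma>" "lattice_basis L B" "G \<subseteq> B" "\<sigma> = convex_cone hull G"
    and u: "u \<in> primitive_vectors L \<Sigma>" "u \<in> \<sigma>"
  shows "u \<in> G"
proof -
  note B = lattice_basisD[OF \<sigma>(2)]
  define \<rho> where "\<rho> = convex_cone hull {u}"
  have ray: "\<rho> \<in> fan_rays \<Sigma>" and gen: "primitive_generator L \<rho> u"
    using primitive_vector_ray[OF u(1)] by (simp_all add: \<rho>_def)
  have "\<rho> \<in> cone_rays \<Sigma> \<sigma>" using cone_rays_iff[OF \<sigma>(1) u(1)] u(2) by (simp add: \<rho>_def)
  then have face: "\<rho> face_of \<sigma>" by (simp add: cone_rays_def cone_face_of_def)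
  have u_ray: "u \<in> \<rho>" by (simp add: \<rho>_def hull_inc)
  have r: "0 \<le> representation B u g" "g \<notin> G \<Longrightarrow> representation B u g = 0" for g
    using mem_basis_cone_iff[OF B \<sigma>(3), of u] u(2) \<sigma>(4) by auto
  have "u \<noteq> 0" using gen by (simp add: primitive_generator_def primitive_def)
  moreover have "u = (\<Sum>b\<in>B. representation B u b *\<^sub>R b)"
    using sum_representation_eq[of B u B] B by simp
  ultimately obtain g where g: "representation B u g \<noteq> 0"
    by (metis (no_types, lifting) scale_eq_0_iff sum.neutral)
  then have gG: "g \<in> G" using r by blast
  then have gB: "g \<in> B" using \<sigma>(3) by blast
  define t where "t = representation B u g"
  have t: "0 < t" using g r(1)[of g] by (simp add: t_def)
  \<comment> \<open>\<open>u\<close> is the midpoint of \<open>a\<close> and \<open>c\<close>: its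
    \<open>g\<close>-part is doubled in \<open>a\<close>, the rest in \<open>c\<close>. Since the
    ray is a face containing \<open>u\<close>, it contains \<open>a\<close>, hence
    \<open>g\<close>.\<close>
  define a where "a = (2 * t) *\<^sub>R g"
  define c where "c = 2 *\<^sub>R (u - t *\<^sub>R g)"
  have a: "a \<in> \<sigma>"
    unfolding a_def \<sigma>(4) using gG t by (intro convex_cone_hull_mul hull_inc) auto
  have rep: "representation B (u - t *\<^sub>R g) b = (if b = g then 0 else representation B u b)" for b
    using B gB by (simp add: representation_diff representation_scale representation_basis t_def)
  have c: "c \<in> \<sigma>"
    unfolding c_def \<sigma>(4)
    by (rule convex_cone_hull_mul) (use mem_basis_cone_iff[OF B \<sigma>(3)] rep r in auto)
  \<comment> \<open>An open segment between equal points is empty. The \<open>g\<close>-coordinates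
    \<open>2 * t\<close> and 0 tell the endpoints apart.\<close>
  have "a \<noteq> c"
  proof
    assume "a = c"
    then have "representation B a g = representation B c g" by simp
    then show False
      using B gB t rep[of g] by (simp add: a_def c_def representation_scale representation_basis)
  qed
  moreover have "u = (1 - 1/2) *\<^sub>R a + (1/2) *\<^sub>R c"
    by (simp add: a_def c_def)
  ultimately have "u \<in> open_segment a c"
    unfolding in_segment by (intro conjI exI[of _ "1/2"]) simp_all
  then have "a \<in> \<rho>" using face a c u_ray unfolding face_of_def by blast
  then have "(1 / (2 * t)) *\<^sub>R a \<in> \<rho>"
    unfolding \<rho>_def using t by (intro convex_cone_hull_mul) auto
  then have g_ray: "g \<in> \<rho>" using t by (simp add: a_def)
  \<comment> \<open>The ray is a smooth cone with a basis \<open>B'\<close> of its own; both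
    \<open>g\<close> and \<open>u\<close> are primitive on it, so both equal its generator.\<close>
  obtain B' b where B': "lattice_basis L B'" "b \<in> B'" "\<rho> = convex_cone hull {b}"
    using smooth_ray[OF ray] .
  have "g = b"
    using primitive_in_basis_ray[OF B'(1,2) basis_primitive[OF \<sigma>(2) gB]] g_ray B'(3) by simp
  moreover have "u = b"
    using primitive_in_basis_ray[OF B'(1,2)] gen u_ray B'(3) by (simp add: primitive_generator_def)
  ultimately show ?thesis using gG by simp
qed

text \<open>Primitive vectors in a cone belong to its generating part of a basis, and a subset of
  that spans a face, which is again in the fan.\<close>

lemma part_of_cone_iff_spans_cone:
  assumes C: "C \<subseteq> primitive_vectors L \<Sigma>"
  shows "part_of_cone L \<Sigma> C \<longleftrightarrow> spans_cone \<Sigma> C"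
proof
  assume "part_of_cone L \<Sigma> C"
  then obtain \<sigma> where \<sigma>: "\<sigma> \<in> \<Sigma>" "C \<subseteq> \<sigma>" using part_of_cone_iff[OF C] by blast
  obtain B G where B: "lattice_basis L B" "G \<subseteq> B" "\<sigma> = convex_cone hull G"
    using smooth_cone[OF \<sigma>(1)] .
  have "C \<subseteq> G" using primitive_vector_in_cone[OF \<sigma>(1) B] \<sigma>(2) C by blast
  then have "cone_face_of (convex_cone hull C) \<sigma>"
    using basis_cone_face[OF lattice_basisD[OF B(1)] B(2)] B(3)
    by (simp add: cone_face_of_def convex_cone_hull_nonempty)
  then show "spans_cone \<Sigma> C" using fan_face[OF \<sigma>(1)] by (simp add: spans_cone_def)
next
  assume "spans_cone \<Sigma> C"
  then show "part_of_cone L \<Sigma> C"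
    using part_of_cone_iff[OF C] hull_subset[of C convex_cone] unfolding spans_cone_def by blast
qed

end

section \<open>The components of the irrelevant locus\<close>

lemma zero_locus_genideal:
  assumes "ring R" "S \<subseteq> carrier R"
  shows "zero_locus R (Idl\<^bsub>R\<^esub> S) = zero_locus R S"
proof -
  interpret ring R by fact
  have "Idl\<^bsub>R\<^esub> S \<subseteq> P \<longleftrightarrow> S \<subseteq> P" if "P \<in> spec R" for P
  proof -
    have "ideal P R" using that by (simp add: spec_def primeideal_def)
    then show ?thesis using Idl_subset_ideal[OF _ assms(2)] by simp
  qed
  then show ?thesis unfolding zero_locus_def by blast
qed

lemma prod_coord_mem_prime:
  fixes P :: "('i, 'k::field) mpoly set"
  assumes P: "P \<in> spec (polynomial_ring I)" and "finite J" "J \<subseteq> I"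
  shows "(\<Prod>i\<in>J. coord i) \<in> P \<longleftrightarrow> (\<exists>i\<in>J. coord i \<in> P)"
  using assms(2,3)
proof (induction J rule: finite_induct)
  case empty
  then show ?case using P by (simp add: spec_polynomial_ring_iff)
next
  case (insert i J)
  have "coord i \<in> polys I" "(\<Prod>i\<in>J. coord i) \<in> polys I"
    using insert.prems by (auto intro!: coord_polys polys_prod)
  then have "coord i * (\<Prod>i\<in>J. coord i) \<in> P \<longleftrightarrow> coord i \<in> P \<or> (\<Prod>i\<in>J. coord i) \<in> P"
    using specD(3)[OF P, of "coord i" "\<Prod>i\<in>J. coord i"] by (simp add: polynomial_ring_def)
  then show ?case using insert by simp
qed

lemma minimal_subset:
  assumes "finite T" "P T"
  obtains C where "C \<subseteq> T" "P C" "\<forall>D\<subset>C. \<not> P D"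
proof -
  have "finite {C \<in> Pow T. P C}" "T \<in> {C \<in> Pow T. P C}" using assms by simp_all
  then obtain C where C: "C \<in> {C \<in> Pow T. P C}" "\<forall>D\<in>{C \<in> Pow T. P C}. D \<subseteq> C \<longrightarrow> C = D"
    using finite_has_minimal[of "{C \<in> Pow T. P C}"] by auto
  have "\<not> P D" if "D \<subset> C" for D
  proof
    assume "P D"
    then have "D \<in> {C \<in> Pow T. P C}" using that C(1) by auto
    then show False using C(2) that by auto
  qed
  then show thesis using that[of C] C(1) by simp
qed

text \<open>Batyrev's primitive collections of the fan; \<open>primitive_collections\<close>, in
  contrast, prescribes only a cardinality.\<close>

definition minimal_nonfaces :: "'v::real_vector set \<Rightarrow> 'v set set \<Rightarrow> 'v set set" where
  "minimal_nonfaces L \<Sigma> =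
    {C. C \<subseteq> primitive_vectors L \<Sigma> \<and> \<not> part_of_cone L \<Sigma> C \<and> (\<forall>D\<subset>C. part_of_cone L \<Sigma> D)}"

lemma part_of_cone_mono: "part_of_cone L \<Sigma> C \<Longrightarrow> D \<subseteq> C \<Longrightarrow> part_of_cone L \<Sigma> D"
  unfolding part_of_cone_def by blast

abbreviation (input) ray :: "'v::real_vector \<Rightarrow> 'v set" where
  "ray u \<equiv> convex_cone hull {u}"

context
  fixes L :: "'v::real_vector set" and \<Sigma> :: "'v set set"
  assumes smooth: "smooth_fan L \<Sigma>"
begin

lemma coordinate_subspace_eq:
  assumes "C \<subseteq> primitive_vectors L \<Sigma>"
  shows "coordinate_subspace L \<Sigma> C = coord_locus (fan_rays \<Sigma>) (ray ` C)"
proof -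
  have "{\<rho> \<in> fan_rays \<Sigma>. \<exists>u\<in>C. primitive_generator L \<rho> u} = ray ` C"
    using primitive_vector_ray[OF smooth] assms by (auto simp: primitive_generator_def)
  then show ?thesis by (simp add: coordinate_subspace_def coord_locus_def)
qed

lemma rays_subset: "C \<subseteq> primitive_vectors L \<Sigma> \<Longrightarrow> ray ` C \<subseteq> fan_rays \<Sigma>"
  using bij_betw_primitive_vectors_rays[OF smooth] unfolding bij_betw_def by blast

lemma inj_on_ray: "C \<subseteq> primitive_vectors L \<Sigma> \<Longrightarrow> inj_on ray C"
  using bij_betw_primitive_vectors_rays[OF smooth] unfolding bij_betw_def
  by (blast intro: inj_on_subset)

lemma coordinate_subspace_subset_iff:
  assumes "C \<subseteq> primitive_vectors L \<Sigma>" "D \<subseteq> primitive_vectors L \<Sigma>"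
  shows "(coordinate_subspace L \<Sigma> C :: ('v set, 'k::field) mpoly set set) \<subseteq> coordinate_subspace L \<Sigma> D
    \<longleftrightarrow> D \<subseteq> C"
proof -
  have "ray ` D \<subseteq> ray ` C \<longleftrightarrow> D \<subseteq> C"
    by (rule inj_on_image_subset_iff[OF inj_on_ray[OF order_refl] assms(2,1)])
  then show ?thesis
    using assms by (simp add: coordinate_subspace_eq coord_locus_subset_iff rays_subset)
qed

lemma coordinate_subspace_Int:
  "C \<subseteq> primitive_vectors L \<Sigma> \<Longrightarrow> D \<subseteq> primitive_vectors L \<Sigma> \<Longrightarrow>
    coordinate_subspace L \<Sigma> C \<inter> coordinate_subspace L \<Sigma> D = coordinate_subspace L \<Sigma> (C \<union> D)"
  by (simp add: coordinate_subspace_eq coord_locus_Int image_Un)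

lemma closedin_coordinate_subspace:
  "C \<subseteq> primitive_vectors L \<Sigma> \<Longrightarrow> closedin (affine_space (fan_rays \<Sigma>)) (coordinate_subspace L \<Sigma> C)"
  by (simp add: coordinate_subspace_eq closedin_coord_locus rays_subset)

lemma irreducible_coordinate_subspace:
  "C \<subseteq> primitive_vectors L \<Sigma> \<Longrightarrow> irreducible_subset (affine_space (fan_rays \<Sigma>)) (coordinate_subspace L \<Sigma> C)"
  by (simp add: coordinate_subspace_eq irreducible_coord_locus rays_subset)

lemma codim_coordinate_subspace:
  "C \<subseteq> primitive_vectors L \<Sigma> \<Longrightarrow> irreducible_codim (affine_space (fan_rays \<Sigma>))
     (coordinate_subspace L \<Sigma> C :: ('v set, 'k::field) mpoly set set) = enat (card C)"
  by (simp add: coordinate_subspace_eq codim_coord_locus finite_fan_rays[OF smooth] rays_subset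
      card_image inj_on_ray)

text \<open>Formulated for any antichain, to serve both for the whole locus and for a single
  coordinate subspace such as an intersection of two components.\<close>

lemma components_of_coordinate_subspaces:
  assumes N: "N \<subseteq> Pow (primitive_vectors L \<Sigma>)"
    and antichain: "\<And>C D. C \<in> N \<Longrightarrow> D \<in> N \<Longrightarrow> C \<subseteq> D \<Longrightarrow> C = D"
  shows "components_of_subset (affine_space (fan_rays \<Sigma>))
      (\<Union>(coordinate_subspace L \<Sigma> ` N) :: ('v set, 'k::field) mpoly set set) =
    coordinate_subspace L \<Sigma> ` N"
proof (rule components_of_finite_Union)
  show "finite (coordinate_subspace L \<Sigma> ` N :: ('v set, 'k) mpoly set set set)"
    using finite_subset[OF N] finite_primitive_vectors[OF smooth] by blast
next
  fix Y Y' :: "('v set, 'k) mpoly set set"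
  assume "Y \<in> coordinate_subspace L \<Sigma> ` N" "Y' \<in> coordinate_subspace L \<Sigma> ` N" "Y \<subseteq> Y'"
  then obtain C D where CD: "C \<in> N" "D \<in> N" "Y = coordinate_subspace L \<Sigma> C" "Y' = coordinate_subspace L \<Sigma> D"
    "(coordinate_subspace L \<Sigma> C :: ('v set, 'k) mpoly set set) \<subseteq> coordinate_subspace L \<Sigma> D" by blast
  then have "D \<subseteq> C" using coordinate_subspace_subset_iff[of C D, where 'k = 'k] N by blast
  then show "Y = Y'" using antichain[of D C] CD by simp
qed (use N closedin_coordinate_subspace irreducible_coordinate_subspace in blast)+

lemma components_of_coordinate_subspace:
  assumes "C \<subseteq> primitive_vectors L \<Sigma>"
  shows "components_of_subset (affine_space (fan_rays \<Sigma>))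
      (coordinate_subspace L \<Sigma> C :: ('v set, 'k::field) mpoly set set) = {coordinate_subspace L \<Sigma> C}"
  using components_of_coordinate_subspaces[of "{C}", where 'k = 'k] assms by simp

text \<open>A prime contains the monomial of \<sigma> iff it contains one of its variables. So it
  contains all these monomials iff the vectors whose coordinates vanish at it lie in no common cone,
  that is, iff they include a minimal nonface.\<close>

lemma irrelevant_locus_eq:
  "(irrelevant_locus \<Sigma> :: ('v set, 'k::field) mpoly set set) =
    \<Union>(coordinate_subspace L \<Sigma> ` minimal_nonfaces L \<Sigma>)"
proof -
  let ?R = "polynomial_ring (fan_rays \<Sigma>) :: ('v set, 'k) mpoly ring"
  have carrier: "cone_monomial \<Sigma> ` \<Sigma> \<subseteq> carrier ?R"
    by (auto simp: cone_monomial_def intro!: polys_prod coord_polys)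
  have Z: "irrelevant_locus \<Sigma> = zero_locus ?R (cone_monomial \<Sigma> ` \<Sigma>)"
    unfolding irrelevant_locus_def irrelevant_ideal_def
    by (rule zero_locus_genideal[OF cring.axioms(1)[OF cring_polynomial_ring] carrier])
  have "P \<in> irrelevant_locus \<Sigma> \<longleftrightarrow> (\<exists>C\<in>minimal_nonfaces L \<Sigma>. P \<in> coordinate_subspace L \<Sigma> C)"
    if P: "P \<in> spec ?R" for P
  proof -
    \<comment> \<open>The largest collection whose coordinate subspace contains
      \<open>P\<close>.\<close>
    define T where "T = {u \<in> primitive_vectors L \<Sigma>. coord (ray u) \<in> P}"
    have TK: "T \<subseteq> primitive_vectors L \<Sigma>" by (auto simp: T_def)
    have in_cs: "P \<in> coordinate_subspace L \<Sigma> C \<longleftrightarrow> C \<subseteq> T" if "C \<subseteq> primitive_vectors L \<Sigma>" for C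
      using that P by (auto simp: coordinate_subspace_eq coord_locus_def zero_locus_def T_def)
    have mon: "cone_monomial \<Sigma> \<sigma> \<in> P \<longleftrightarrow> \<not> T \<subseteq> \<sigma>" if \<sigma>: "\<sigma> \<in> \<Sigma>" for \<sigma>
    proof -
      have "cone_monomial \<Sigma> \<sigma> \<in> P \<longleftrightarrow> (\<exists>\<rho>\<in>fan_rays \<Sigma> - cone_rays \<Sigma> \<sigma>. coord \<rho> \<in> P)"
        unfolding cone_monomial_def
        using finite_fan_rays[OF smooth] by (intro prod_coord_mem_prime[OF P]) auto
      also have "\<dots> \<longleftrightarrow> (\<exists>u\<in>primitive_vectors L \<Sigma>. ray u \<notin> cone_rays \<Sigma> \<sigma> \<and> coord (ray u) \<in> P)"
        using bij_betw_imp_surj_on[OF bij_betw_primitive_vectors_rays[OF smooth], symmetric] by auto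
      also have "\<dots> \<longleftrightarrow> \<not> T \<subseteq> \<sigma>"
        using cone_rays_iff[OF smooth \<sigma>] by (auto simp: T_def)
      finally show ?thesis .
    qed
    have "P \<in> irrelevant_locus \<Sigma> \<longleftrightarrow> (\<forall>\<sigma>\<in>\<Sigma>. cone_monomial \<Sigma> \<sigma> \<in> P)"
      using P by (auto simp: Z zero_locus_def)
    also have "\<dots> \<longleftrightarrow> \<not> part_of_cone L \<Sigma> T"
      using mon part_of_cone_iff[OF smooth TK] by blast
    also have "\<dots> \<longleftrightarrow> (\<exists>C\<in>minimal_nonfaces L \<Sigma>. C \<subseteq> T)"
    proof
      assume T: "\<not> part_of_cone L \<Sigma> T"
      have "finite T" using TK finite_primitive_vectors[OF smooth] by (rule finite_subset)
      then obtain C where "C \<subseteq> T" "\<not> part_of_cone L \<Sigma> C"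
        "\<forall>D\<subset>C. \<not> \<not> part_of_cone L \<Sigma> D"
        using T by (rule minimal_subset)
      then show "\<exists>C\<in>minimal_nonfaces L \<Sigma>. C \<subseteq> T"
        using TK unfolding minimal_nonfaces_def by blast
    next
      assume "\<exists>C\<in>minimal_nonfaces L \<Sigma>. C \<subseteq> T"
      then show "\<not> part_of_cone L \<Sigma> T"
        unfolding minimal_nonfaces_def using part_of_cone_mono[of L \<Sigma> T] by blast
    qed
    also have "\<dots> \<longleftrightarrow> (\<exists>C\<in>minimal_nonfaces L \<Sigma>. P \<in> coordinate_subspace L \<Sigma> C)"
      using in_cs unfolding minimal_nonfaces_def by blast
    finally show ?thesis .
  qed
  moreover have "irrelevant_locus \<Sigma> \<subseteq> spec ?R" "coordinate_subspace L \<Sigma> C \<subseteq> spec ?R" for C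
    by (auto simp: irrelevant_locus_def coordinate_subspace_def zero_locus_def)
  ultimately show ?thesis by blast
qed

lemma components_of_irrelevant_locus:
  "components_of_subset (affine_space (fan_rays \<Sigma>))
     (irrelevant_locus \<Sigma> :: ('v set, 'k::field) mpoly set set) =
   coordinate_subspace L \<Sigma> ` minimal_nonfaces L \<Sigma>"
  unfolding irrelevant_locus_eq
proof (rule components_of_coordinate_subspaces)
  show "minimal_nonfaces L \<Sigma> \<subseteq> Pow (primitive_vectors L \<Sigma>)" by (auto simp: minimal_nonfaces_def)
  show "C = D" if "C \<in> minimal_nonfaces L \<Sigma>" "D \<in> minimal_nonfaces L \<Sigma>" "C \<subseteq> D" for C D
    using that unfolding minimal_nonfaces_def by blast
qed

end

theorem proposition5p12:
  fixes L :: "'v::real_vector set" and \<Sigma> :: "'v set set" and d :: nat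
    and A :: "('v set, 'k::field) mpoly set topology"
    and Z :: "('v set, 'k) mpoly set set"
  assumes "full_lattice L"
    and "smooth_fan L \<Sigma>"
    and "proper_fan L \<Sigma>"
    and "A = affine_space (fan_rays \<Sigma>)"
    and "Z = irrelevant_locus \<Sigma>"
    and "1 \<le> d"
    and "d \<le> card (fan_rays \<Sigma>)"
  shows
    "(codim_ge A Z d \<longleftrightarrow> (\<forall>C\<in>primitive_collections L \<Sigma> (d - 1). part_of_cone L \<Sigma> C))
   \<and>
    ((\<forall>C\<in>primitive_collections L \<Sigma> (d - 1). part_of_cone L \<Sigma> C) \<longrightarrow>
       ((\<exists>C\<in>primitive_collections L \<Sigma> d. \<not> part_of_cone L \<Sigma> C) \<longrightarrow>
          components_of_codim A Z d \<noteq> {}) \<and>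
       bij_betw (coordinate_subspace L \<Sigma>)
         {C \<in> primitive_collections L \<Sigma> d. \<not> part_of_cone L \<Sigma> C}
         (components_of_codim A Z d))
   \<and>
    (has_codim A Z d \<longrightarrow>
       (\<forall>C\<^sub>1\<in>{C \<in> primitive_collections L \<Sigma> d. \<not> part_of_cone L \<Sigma> C}.
        \<forall>C\<^sub>2\<in>{C \<in> primitive_collections L \<Sigma> d. \<not> part_of_cone L \<Sigma> C}.
        \<forall>Y\<^sub>1\<in>components_of_codim A Z d. \<forall>Y\<^sub>2\<in>components_of_codim A Z d.
          Y\<^sub>1 = coordinate_subspace L \<Sigma> C\<^sub>1 \<and> Y\<^sub>2 = coordinate_subspace L \<Sigma> C\<^sub>2 \<longrightarrow>
          (has_codim A (Y\<^sub>1 \<inter> Y\<^sub>2) (d + 1) \<longleftrightarrow> card (C\<^sub>1 \<inter> C\<^sub>2) = d - 1)))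
   \<and>
    (has_codim A Z d \<longrightarrow>
       ((\<forall>Y\<^sub>1\<in>components_of_codim A Z d. \<forall>Y\<^sub>2\<in>components_of_codim A Z d.
           Y\<^sub>1 \<noteq> Y\<^sub>2 \<longrightarrow> codim_ge A (Y\<^sub>1 \<inter> Y\<^sub>2) (d + 2)) \<longleftrightarrow>
        (\<forall>C\<in>primitive_collections L \<Sigma> (d - 1). spans_cone \<Sigma> C \<longrightarrow>
           (\<exists>\<^sub>\<le>\<^sub>1 u. u \<in> primitive_vectors L \<Sigma> \<and> u \<notin> C \<and> \<not> spans_cone \<Sigma> (insert u C)))))"
proof -
  note smooth = assms(2)
  let ?K = "primitive_vectors L \<Sigma>"
  let ?cs = "coordinate_subspace L \<Sigma> :: 'v set \<Rightarrow> ('v set, 'k) mpoly set set"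
  let ?N = "minimal_nonfaces L \<Sigma>"
  let ?face = "part_of_cone L \<Sigma>"
  let ?F = "\<forall>C\<in>primitive_collections L \<Sigma> (d - 1). ?face C"
  define B where "B = {C \<in> primitive_collections L \<Sigma> d. \<not> ?face C}"
  have finK: "finite ?K" by (rule finite_primitive_vectors[OF smooth])
  have cardK: "d \<le> card ?K"
    using bij_betw_same_card[OF bij_betw_primitive_vectors_rays[OF smooth]] assms(7) by simp
  have coll: "C \<in> primitive_collections L \<Sigma> n \<longleftrightarrow> C \<subseteq> ?K \<and> card C = n" for C n
    using finite_subset[OF _ finK] by (auto simp: primitive_collections_def)
  have fin: "finite C" if "C \<subseteq> ?K" for C using finite_subset[OF that finK] .
  have NK: "C \<subseteq> ?K" if "C \<in> ?N" for C using that by (simp add: minimal_nonfaces_def)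
  have BK: "C \<subseteq> ?K" "card C = d" "\<not> ?face C" if "C \<in> B" for C using that by (auto simp: B_def coll)
  have codim: "irreducible_codim A (?cs C) = enat (card C)" if "C \<subseteq> ?K" for C
    unfolding assms(4) by (rule codim_coordinate_subspace[OF smooth that])
  have compsZ: "components_of_subset A Z = ?cs ` ?N"
    unfolding assms(4,5) by (rule components_of_irrelevant_locus[OF smooth])
  have comps1: "components_of_subset A (?cs C) = {?cs C}" if "C \<subseteq> ?K" for C
    unfolding assms(4) by (rule components_of_coordinate_subspace[OF smooth that])
  have Int: "?cs C \<inter> ?cs D = ?cs (C \<union> D)" if "C \<subseteq> ?K" "D \<subseteq> ?K" for C D
    by (rule coordinate_subspace_Int[OF smooth that])
  have inj: "inj_on ?cs (Pow ?K)"
  proof (rule inj_onI)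
    fix C D assume "C \<in> Pow ?K" "D \<in> Pow ?K" "?cs C = ?cs D"
    then have "C \<subseteq> D" "D \<subseteq> C"
      using coordinate_subspace_subset_iff[OF smooth, of C D, where 'k = 'k]
        coordinate_subspace_subset_iff[OF smooth, of D C, where 'k = 'k] by simp_all
    then show "C = D" by blast
  qed
  have geZ: "codim_ge A Z d \<longleftrightarrow> (\<forall>C\<in>?N. d \<le> card C)"
    using codim NK by (auto simp: codim_ge_def compsZ)
  have ge1: "codim_ge A (?cs C) n \<longleftrightarrow> n \<le> card C" if "C \<subseteq> ?K" for C n
    using codim[OF that] by (simp add: codim_ge_def comps1[OF that])
  have has1: "has_codim A (?cs C) n \<longleftrightarrow> card C = n" if "C \<subseteq> ?K" for C n
    using codim[OF that] ge1[OF that]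
    by (auto simp: has_codim_def components_of_codim_def comps1[OF that])
  \<comment> \<open>A nonface with \<open>d - 1\<close> elements contains a minimal one that is no
    larger; conversely a minimal nonface with fewer than \<open>d\<close> elements can be enlarged
    to size \<open>d - 1\<close>.\<close>
  have 1: "codim_ge A Z d \<longleftrightarrow> ?F"
  proof
    assume ge: "codim_ge A Z d"
    show ?F
    proof (rule ballI, rule ccontr)
      fix C assume "C \<in> primitive_collections L \<Sigma> (d - 1)" and "\<not> ?face C"
      then have C: "C \<subseteq> ?K" "card C = d - 1" "\<not> ?face C" by (simp_all add: coll)
      obtain D where D: "D \<subseteq> C" "\<not> ?face D" "\<forall>E\<subset>D. \<not> \<not> ?face E"
        using fin[OF C(1)] C(3) by (rule minimal_subset)
      then have "D \<in> ?N" using C by (auto simp: minimal_nonfaces_def)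
      then have "d \<le> card D" using ge geZ by blast
      moreover have "card D \<le> card C" using D C fin by (intro card_mono) auto
      \<comment> \<open>\<open>1 \<le> d\<close> makes \<open>d - 1\<close> a true predecessor,
        which the truncated subtraction would not give at 0.\<close>
      ultimately show False using C assms(6) by simp
    qed
  next
    assume F: ?F
    have "d \<le> card D" if D: "D \<in> ?N" for D
    proof (rule ccontr)
      assume "\<not> d \<le> card D"
      \<comment> \<open>The bound of \<open>d\<close> by the number of rays leaves enough primitive
        vectors for the enlargement.\<close>
      then have "card D \<le> d - 1" "d - 1 \<le> card ?K" using cardK by simp_all
      then obtain C where C: "D \<subseteq> C" "C \<subseteq> ?K" "card C = d - 1"
        using exists_subset_between[of D "d - 1" ?K] NK[OF D] finK by blast
      then have "?face C" using F coll by blast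
      then have "?face D" using C(1) by (rule part_of_cone_mono)
      then show False using D by (simp add: minimal_nonfaces_def)
    qed
    then show "codim_ge A Z d" using geZ by blast
  qed
  \<comment> \<open>Nonfaces of size \<open>d\<close> are automatically minimal: a proper subset
    misses some \<open>x\<close>, and removing \<open>x\<close> alone leaves a collection of size
    \<open>d - 1\<close>.\<close>
  have B_eq: "B = {C \<in> ?N. card C = d}" if F: ?F
  proof -
    have "?face D" if C: "C \<in> B" and D: "D \<subset> C" for C D
    proof -
      obtain x where x: "x \<in> C" "D \<subseteq> C - {x}" using D by blast
      then have "C - {x} \<in> primitive_collections L \<Sigma> (d - 1)"
        using BK[OF C] fin by (auto simp: coll)
      then have "?face (C - {x})" using F by blast
      then show ?thesis using x(2) by (rule part_of_cone_mono)
    qed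
    then show ?thesis by (auto simp: B_def coll minimal_nonfaces_def)
  qed
  have codimZ: "components_of_codim A Z d = ?cs ` B" if ?F
    using codim NK by (auto simp: components_of_codim_def compsZ B_eq[OF that])
  have 2: "(B \<noteq> {} \<longrightarrow> components_of_codim A Z d \<noteq> {}) \<and>
      bij_betw ?cs B (components_of_codim A Z d)" if ?F
  proof -
    have "inj_on ?cs B" using inj by (rule inj_on_subset) (use BK in auto)
    then show ?thesis using codimZ[OF that] by (simp add: bij_betw_def)
  qed
  have F: ?F if "has_codim A Z d" using that 1 by (simp add: has_codim_def)
  have card_Un: "card (C \<union> D) + card (C \<inter> D) = d + d" if "C \<in> B" "D \<in> B" for C D
    using card_Un_Int[of C D] BK that fin by simp
  \<comment> \<open>The intersection is the coordinate subspace of \<open>C \<union> D\<close>,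
    whose size is \<open>2 d\<close> minus the size of \<open>C \<inter> D\<close>.\<close>
  have 3: "has_codim A (?cs C \<inter> ?cs D) (d + 1) \<longleftrightarrow> card (C \<inter> D) = d - 1"
    if "C \<in> B" "D \<in> B" for C D
    using Int[of C D] has1[of "C \<union> D"] BK that card_Un[OF that] assms(6) by auto
  have 4: "(\<forall>Y\<^sub>1\<in>components_of_codim A Z d. \<forall>Y\<^sub>2\<in>components_of_codim A Z d.
           Y\<^sub>1 \<noteq> Y\<^sub>2 \<longrightarrow> codim_ge A (Y\<^sub>1 \<inter> Y\<^sub>2) (d + 2)) \<longleftrightarrow>
        (\<forall>C\<in>primitive_collections L \<Sigma> (d - 1). spans_cone \<Sigma> C \<longrightarrow>
           (\<exists>\<^sub>\<le>\<^sub>1 u. u \<in> ?K \<and> u \<notin> C \<and> \<not> spans_cone \<Sigma> (insert u C)))" (is "?L \<longleftrightarrow> ?R")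
    if codimd: "has_codim A Z d"
  proof -
    note F = F[OF codimd]
    have "?L \<longleftrightarrow> (\<forall>C\<in>B. \<forall>D\<in>B. ?cs C \<noteq> ?cs D \<longrightarrow> codim_ge A (?cs C \<inter> ?cs D) (d + 2))"
      by (simp add: codimZ[OF F])
    also have "\<dots> \<longleftrightarrow> (\<forall>C\<in>B. \<forall>D\<in>B. C \<noteq> D \<longrightarrow> d + 2 \<le> card (C \<union> D))"
    proof -
      have "?cs C \<noteq> ?cs D \<longleftrightarrow> C \<noteq> D" "codim_ge A (?cs C \<inter> ?cs D) (d + 2) \<longleftrightarrow> d + 2 \<le> card (C \<union> D)"
        if "C \<in> B" "D \<in> B" for C D
        using inj_on_eq_iff[OF inj, of C D] Int[of C D] ge1[of "C \<union> D" "d + 2"] BK(1)[OF that(1)]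
          BK(1)[OF that(2)] by auto
      then show ?thesis by (intro ball_cong refl) simp
    qed
    \<comment> \<open>Two different sets of size \<open>d\<close> with a union of at most
      \<open>d + 1\<close> elements are \<open>insert u E\<close> and \<open>insert w E\<close> for
      one common set \<open>E\<close> of size \<open>d - 1\<close>. A violation on the left is
      therefore a pair of distinct vectors violating uniqueness over \<open>E\<close>.\<close>
    also have "\<dots> \<longleftrightarrow> ?R"
    proof
      assume L: "\<forall>C\<in>B. \<forall>D\<in>B. C \<noteq> D \<longrightarrow> d + 2 \<le> card (C \<union> D)"
      show ?R
      proof (intro ballI impI Uniq_I, rule ccontr)
        fix C u w
        assume "C \<in> primitive_collections L \<Sigma> (d - 1)"
          and u: "u \<in> ?K \<and> u \<notin> C \<and> \<not> spans_cone \<Sigma> (insert u C)"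
          and w: "w \<in> ?K \<and> w \<notin> C \<and> \<not> spans_cone \<Sigma> (insert w C)" and "u \<noteq> w"
        then have C: "C \<subseteq> ?K" "card C = d - 1" "finite C" using fin by (simp_all add: coll)
        have "insert u C \<in> B" "insert w C \<in> B"
          using C u w part_of_cone_iff_spans_cone[OF smooth, of "insert u C"]
            part_of_cone_iff_spans_cone[OF smooth, of "insert w C"] assms(6)
          by (auto simp: B_def coll)
        moreover have "insert u C \<noteq> insert w C" using u w \<open>u \<noteq> w\<close> by blast
        ultimately have "d + 2 \<le> card (insert u C \<union> insert w C)" by (rule L[rule_format])
        also have "insert u C \<union> insert w C = insert u (insert w C)" by blast
        also have "card (insert u (insert w C)) = d + 1"
          using C u w \<open>u \<noteq> w\<close> assms(6) by simp
        finally show False by simp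
      qed
    next
      assume R: ?R
      show "\<forall>C\<in>B. \<forall>D\<in>B. C \<noteq> D \<longrightarrow> d + 2 \<le> card (C \<union> D)"
      proof (intro ballI impI, rule ccontr)
        fix C D assume CD: "C \<in> B" "D \<in> B" "C \<noteq> D" and "\<not> d + 2 \<le> card (C \<union> D)"
        note C = BK[OF CD(1)] and D = BK[OF CD(2)]
        have finC: "finite C" and finD: "finite D" using fin C D by blast+
        have "\<not> C \<subseteq> D" "\<not> D \<subseteq> C"
          using CD(3) C(2) D(2) card_subset_eq[OF finD, of C] card_subset_eq[OF finC, of D] by auto
        then obtain u w where u: "u \<in> C" "u \<notin> D" and w: "w \<in> D" "w \<notin> C" by blast
        have "d - 1 \<le> card (C \<inter> D)" using card_Un[OF CD(1,2)] \<open>\<not> d + 2 \<le> card (C \<union> D)\<close> by simp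
        moreover have "C \<inter> D \<subseteq> C - {u}" "C \<inter> D \<subseteq> D - {w}" using u w by blast+
        moreover have "card (C - {u}) = d - 1" "card (D - {w}) = d - 1"
          using u w C D by simp_all
        \<comment> \<open>\<open>C \<inter> D\<close> has at least \<open>d - 1\<close> elements and
          lies in both of these sets of exactly that size.\<close>
        ultimately have eq: "C \<inter> D = C - {u}" "C \<inter> D = D - {w}"
          using card_seteq[of "C - {u}" "C \<inter> D"] card_seteq[of "D - {w}" "C \<inter> D"] finC finD by auto
        then have ins: "insert u (C \<inter> D) = C" "insert w (C \<inter> D) = D" using u w by blast+
        have coll': "C \<inter> D \<in> primitive_collections L \<Sigma> (d - 1)"
          using eq(1) C(1) \<open>card (C - {u}) = d - 1\<close> by (auto simp: coll)
        \<comment> \<open>The condition of part (1) supplies the premise under which uniqueness is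
          assumed.\<close>
        then have "spans_cone \<Sigma> (C \<inter> D)"
          using F part_of_cone_iff_spans_cone[OF smooth, of "C \<inter> D"] by (auto simp: coll)
        then have uniq: "\<exists>\<^sub>\<le>\<^sub>1 u. u \<in> ?K \<and> u \<notin> C \<inter> D \<and> \<not> spans_cone \<Sigma> (insert u (C \<inter> D))"
          using R coll' by blast
        have "\<not> spans_cone \<Sigma> C" "\<not> spans_cone \<Sigma> D"
          using C D part_of_cone_iff_spans_cone[OF smooth] by blast+
        then have "u = w" using Uniq_D[OF uniq, of u w] u w C(1) D(1) by (auto simp: ins)
        then show False using u w by blast
      qed
    qed
    finally show ?thesis .
  qed
  have B_ne: "(\<exists>C\<in>primitive_collections L \<Sigma> d. \<not> ?face C) \<longleftrightarrow> B \<noteq> {}"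
    by (auto simp: B_def)
  show ?thesis
    unfolding B_ne B_def[symmetric] using 1 2 3 4 by (intro conjI impI ballI) auto
qed

end
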